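(* Let $G$ be a finitely generated abelian group of rank $r$ and let $\Sigma$ be a finite symmetric generating set for $G$. Let $S$ be any non-empty finite connected labelled directed subgraph of the Cayley graph $\Gamma(G,\Sigma)$. Then the growth function $C(S,z)=\sum_{j=0}^{\infty}c_j(S)z^j$ is a rational function with integral coefficients and its denominator is $(1-z)^r$; that is, $C(S,z)=P(z)/(1-z)^r$ in lowest terms for some polynomial $P(z)$ with integer coefficients.
   Context: A generating set $\Sigma$ is symmetric if $x\in\Sigma$ implies $x^{-1}\in\Sigma$. The rank of a finitely generated abelian group is its torsion-free rank. $\Gamma=\Gamma(G,\Sigma)$ is the Cayley graph: its vertices are the elements of $G$, and for $g\in G$, $x\in\Sigma$ there is a directed edge labelled $x$ from $g$ to $gx$. Each edge is given length $1$ and the distance is extended to all points of $\Gamma$ (including interior points of edges), making $\Gamma$ a geodesic metric space. $\Gamma_n$ is the ball of radius $n$ in $\Gamma$ centred at the identity element of $G$. A morphism $f:S\to\Gamma$ maps each vertex to a vertex and each labelled directed edge to a directed edge with the same label, so that the initial and final endpoints of a directed edge of $S$ are mapped to the initial and final endpoints, respectively, of the corresponding directed edge of $\Gamma$. A morphism from $S$ to $\Gamma_n$ is a morphism $S\to\Gamma$ whose image lies in $\Gamma_n$. Let $b_n(S)$ be the number of morphisms from $S$ to $\Gamma_n$; set $c_0(S)=b_0(S)$ and $c_n(S)=b_n(S)-b_{n-1}(S)$ for $n\ge 1$. *)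

theory Defs
  imports
    Complex_Main
    "HOL-Library.FuncSet"
    "HOL-Algebra.Generated_Groups"
    "HOL-Algebra.FiniteProduct"
    "HOL-Computational_Algebra.Polynomial_FPS"
    "Graph_Theory.Digraph_Component"
begin

(* Integral linear independence, written multiplicatively. *)
definition int_independent :: "('a, 'm) monoid_scheme \<Rightarrow> 'a set \<Rightarrow> bool" where
  "int_independent G B \<longleftrightarrow>
     (\<forall>k :: 'a \<Rightarrow> int. finprod G (\<lambda>b. b [^]\<^bsub>G\<^esub> k b) B = \<one>\<^bsub>G\<^esub> \<longrightarrow> (\<forall>b\<in>B. k b = 0))"

(* Only meaningful when the cardinalities are bounded, as they are for every finitely
   generated abelian group. *)
definition torsion_free_rank :: "('a, 'm) monoid_scheme \<Rightarrow> nat" where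
  "torsion_free_rank G =
     Max {card B |B. B \<subseteq> carrier G \<and> finite B \<and> int_independent G B}"

(* The arc (g, x) is the edge labelled x that starts at g. *)
definition cayley_graph ::
    "('a, 'm) monoid_scheme \<Rightarrow> 'a set \<Rightarrow> ('a, 'a \<times> 'a) pre_digraph" where
  "cayley_graph G \<Sigma> =
     \<lparr>verts = carrier G, arcs = carrier G \<times> \<Sigma>,
      tail = fst, head = (\<lambda>(g, x). g \<otimes>\<^bsub>G\<^esub> x)\<rparr>"

abbreviation label :: "'a \<times> 'a \<Rightarrow> 'a" where
  "label \<equiv> snd"

(* Edges may be traversed in both directions. *)
definition vertex_dist :: "('v, 'e) pre_digraph \<Rightarrow> 'v \<Rightarrow> 'v \<Rightarrow> nat" where
  "vertex_dist X u v = (LEAST k. (u, v) \<in> parcs (mk_symmetric X) ^^ k)"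

(* Interior e t, for 0 < t < 1, is the point of e at distance t along e from its tail. *)
datatype ('v, 'e) point = Vertex 'v | Interior 'e real

definition points :: "('v, 'e) pre_digraph \<Rightarrow> ('v, 'e) point set" where
  "points X = Vertex ` verts X \<union> {Interior e t |e t. e \<in> arcs X \<and> 0 < t \<and> t < 1}"

(* The vertices at which a path can leave a point without passing through another vertex
   first, each with the length of the edge segment travelled to reach it. *)
fun exits :: "('v, 'e) pre_digraph \<Rightarrow> ('v, 'e) point \<Rightarrow> ('v \<times> real) set" where
  "exits X (Vertex v) = {(v, 0)}"
| "exits X (Interior e t) = {(tail X e, t), (head X e, 1 - t)}"

(* Lengths of the direct segments inside a single edge. *)
fun direct :: "('v, 'e) point \<Rightarrow> ('v, 'e) point \<Rightarrow> real set" where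
  "direct (Interior e s) (Interior e' t) = (if e = e' then {\<bar>s - t\<bar>} else {})"
| "direct _ _ = {}"

(* The path metric on the geometric realisation of a connected graph with edges of length 1. *)
definition point_dist ::
    "('v, 'e) pre_digraph \<Rightarrow> ('v, 'e) point \<Rightarrow> ('v, 'e) point \<Rightarrow> real" where
  "point_dist X p q =
     Min (direct p q \<union>
       (\<lambda>((v, a), (w, b)). a + real (vertex_dist X v w) + b) ` (exits X p \<times> exits X q))"

definition cayley_ball ::
    "('a, 'm) monoid_scheme \<Rightarrow> 'a set \<Rightarrow> nat \<Rightarrow> ('a, 'a \<times> 'a) point set" where
  "cayley_ball G \<Sigma> n =
     {p \<in> points (cayley_graph G \<Sigma>).
        point_dist (cayley_graph G \<Sigma>) (Vertex \<one>\<^bsub>G\<^esub>) p \<le> real n}"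

(* A morphism is a vertex map together with an edge map; the maps are made extensional
   so that morphisms can be counted. *)
definition graph_morphisms ::
    "('a, 'a \<times> 'a) pre_digraph \<Rightarrow> ('a, 'a \<times> 'a) pre_digraph \<Rightarrow>
     (('a \<Rightarrow> 'a) \<times> ('a \<times> 'a \<Rightarrow> 'a \<times> 'a)) set" where
  "graph_morphisms S X =
     {(\<phi>, \<psi>). \<phi> \<in> verts S \<rightarrow>\<^sub>E verts X \<and> \<psi> \<in> arcs S \<rightarrow>\<^sub>E arcs X \<and>
        (\<forall>e\<in>arcs S. label (\<psi> e) = label e \<and>
           tail X (\<psi> e) = \<phi> (tail S e) \<and> head X (\<psi> e) = \<phi> (head S e))}"

fun map_pt :: "('a \<Rightarrow> 'b) \<times> ('e \<Rightarrow> 'f) \<Rightarrow> ('a, 'e) point \<Rightarrow> ('b, 'f) point" where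
  "map_pt (\<phi>, \<psi>) (Vertex v) = Vertex (\<phi> v)"
| "map_pt (\<phi>, \<psi>) (Interior e t) = Interior (\<psi> e) t"

definition ball_count :: "('a, 'm) monoid_scheme \<Rightarrow> 'a set \<Rightarrow> ('a, 'a \<times> 'a) pre_digraph \<Rightarrow> nat \<Rightarrow> nat" where
  "ball_count G \<Sigma> S n =
     card {f \<in> graph_morphisms S (cayley_graph G \<Sigma>). map_pt f ` points S \<subseteq> cayley_ball G \<Sigma> n}"

definition sphere_count :: "('a, 'm) monoid_scheme \<Rightarrow> 'a set \<Rightarrow> ('a, 'a \<times> 'a) pre_digraph \<Rightarrow> nat \<Rightarrow> int" where
  "sphere_count G \<Sigma> S n =
     (if n = 0 then int (ball_count G \<Sigma> S 0) else int (ball_count G \<Sigma> S n) - int (ball_count G \<Sigma> S (n - 1)))"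

definition growth_series ::
    "('a, 'm) monoid_scheme \<Rightarrow> 'a set \<Rightarrow> ('a, 'a \<times> 'a) pre_digraph \<Rightarrow> rat fps" where
  "growth_series G \<Sigma> S = Abs_fps (\<lambda>j. of_int (sphere_count G \<Sigma> S j))"

end

theory Submission
  imports
    Defs
    "HOL-Library.Fun_Lexorder"
    "HOL-Computational_Algebra.Polynomial_Factorial"
begin

text \<open>
  A morphism \<open>f\<close> from \<open>S\<close> to the Cayley graph preserves labels and \<open>S\<close> is connected, so \<open>f\<close> is left
  translation by the element \<open>f v0 \<cdot> v0\<inverse>\<close>, for a fixed base vertex \<open>v0\<close> (\<open>morphism_translate\<close>).
  Hence \<open>b\<^sub>n\<close> counts the set \<open>fits n\<close> of all \<open>g\<close> such that \<open>g S\<close> lies in the ball of radius \<open>n\<close>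
  (\<open>ball_count_eq\<close>). Multiplying \<open>g\<close> by a generator moves every vertex of \<open>g S\<close>, and hence every
  point of an edge, at most one step further out, because \<open>G\<close> is commutative. So the pairs
  \<open>(g, n)\<close> with \<open>g \<in> fits n\<close> are stable under the monoid that is generated by the elements \<open>(x, 1)\<close>
  with \<open>x \<in> \<Sigma>\<close> and by \<open>(1, 1)\<close>. They also lie in a single translate of that monoid, since \<open>g v0\<close>
  is a word of length at most \<open>n\<close>.

  Rationality is a set-theoretic version of the Hilbert-Serre theorem. Exponent vectors in
  \<open>\<nat>\<^sup>k\<close>, with \<open>k = \<bar>\<Sigma>\<bar> + 1\<close>, map onto that translate, and the fibres are the classes of a degree
  preserving congruence. Each class is represented by its lexicographically least element. The vectors
  over pairs \<open>(g, n)\<close> with \<open>g \<in> fits n\<close> form an up-closed set, and so do those among them that are not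
  least in their class. By Dickson's lemma the Hilbert series of an up-closed
  set becomes a polynomial after multiplication by \<open>(1 - z)\<^sup>k\<close>; subtracting two of these series
  gives \<open>graded_action_rational\<close>.

  The order of the pole at \<open>1\<close> is then read off from the growth of \<open>b\<^sub>n\<close>. Cancelling factors
  \<open>1 - z\<close> leaves \<open>\<Sum> b\<^sub>n z\<^sup>n = P(z) / (1 - z)\<^bsup>s+1\<^esup>\<close> with \<open>P(1) \<noteq> 0\<close>, and then \<open>b\<^sub>n / n\<^sup>s\<close> has a nonzero
  limit. An independent set \<open>B\<close> provides \<open>(N + 1)\<^bsup>|B|\<^esup>\<close> distinct products of length \<open>O(N)\<close>, so
  \<open>|B| \<le> s\<close> (\<open>fits_lower_bound\<close>); in particular the maximum that defines the rank exists. If \<open>B\<close>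
  is an independent set of maximal size, some positive power of each generator is a product of
  powers of \<open>B\<close>, so elements of length at most \<open>n\<close> are determined by finitely many remainders and
  \<open>|B|\<close> exponents of size \<open>O(n)\<close>, so \<open>s \<le> |B|\<close> (\<open>fits_upper_bound\<close>). Therefore \<open>s = r\<close>, and passing
  from balls to spheres removes one factor \<open>1 - z\<close>. The fraction is in lowest terms because
  \<open>P(1) \<noteq> 0\<close>.
\<close>

section \<open>Hilbert series of up-closed sets of exponent vectors\<close>

definition vecs :: "nat \<Rightarrow> (nat \<Rightarrow> nat) set" where
  "vecs k = {a. \<forall>i\<ge>k. a i = 0}"

definition deg :: "nat \<Rightarrow> (nat \<Rightarrow> nat) \<Rightarrow> nat" where
  "deg k a = (\<Sum>i<k. a i)"

definition up_set :: "nat \<Rightarrow> (nat \<Rightarrow> nat) set \<Rightarrow> bool" where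
  "up_set k I \<longleftrightarrow> I \<subseteq> vecs k \<and> (\<forall>a\<in>I. \<forall>b\<in>vecs k. a \<le> b \<longrightarrow> b \<in> I)"

definition layer :: "nat \<Rightarrow> (nat \<Rightarrow> nat) set \<Rightarrow> nat \<Rightarrow> (nat \<Rightarrow> nat) set" where
  "layer k I n = {a \<in> I. deg k a = n}"

definition hilbert :: "nat \<Rightarrow> (nat \<Rightarrow> nat) set \<Rightarrow> int fps" where
  "hilbert k I = Abs_fps (\<lambda>n. int (card (layer k I n)))"

lemma vecs_add: "a \<in> vecs k \<Longrightarrow> b \<in> vecs k \<Longrightarrow> (\<lambda>i. a i + b i) \<in> vecs k"
  by (simp add: vecs_def)

lemma vecs_diff: "a \<in> vecs k \<Longrightarrow> (\<lambda>i. a i - b i) \<in> vecs k"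
  by (simp add: vecs_def)

lemma deg_add: "deg k (\<lambda>i. a i + b i) = deg k a + deg k b"
  by (simp add: deg_def sum.distrib)

lemma deg_Suc: "deg (Suc k) a = deg k a + a k"
  by (simp add: deg_def)

lemma deg_upd: "deg k (a(k := x)) = deg k a"
  by (simp add: deg_def)

lemma vecs_Suc_zero: "a \<in> vecs (Suc k) \<Longrightarrow> a k = 0 \<Longrightarrow> a \<in> vecs k"
  unfolding vecs_def mem_Collect_eq by (metis le_neq_implies_less Suc_leI)

lemma vecs_drop: "a \<in> vecs (Suc k) \<Longrightarrow> a(k := 0) \<in> vecs k"
  by (rule vecs_Suc_zero) (auto simp: vecs_def)

lemma finite_layer:
  assumes "I \<subseteq> vecs k" shows "finite (layer k I n)"
proof (rule finite_subset)
  show "layer k I n \<subseteq>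
      {a. \<forall>i. (i \<in> {..<k} \<longrightarrow> a i \<in> {..n}) \<and> (i \<notin> {..<k} \<longrightarrow> a i = 0)}"
    using assms by (auto simp: layer_def deg_def vecs_def not_less
        intro!: member_le_sum[where f = "_ :: nat \<Rightarrow> nat"])
qed (rule finite_set_of_finite_funs, simp_all)

text \<open>
  Dickson's lemma, by induction on the number of coordinates. Forgetting the last coordinate, a
  finite set \<open>F1\<close> generates all projections. It already lies below every vector whose last
  coordinate is at least the bound \<open>J\<close> on the last coordinates of \<open>F1\<close>; each of the finitely many
  slices below \<open>J\<close> has a finite generating set of its own.
\<close>
lemma dickson:
  "A \<subseteq> vecs k \<Longrightarrow> \<exists>F. finite F \<and> F \<subseteq> A \<and> (\<forall>b\<in>A. \<exists>a\<in>F. a \<le> b)"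
proof (induction k arbitrary: A)
  case 0
  have "vecs 0 = {\<lambda>_. 0}" by (auto simp: vecs_def)
  with 0 have "finite A" by (metis finite.emptyI finite.insertI finite_subset)
  moreover have "\<forall>b\<in>A. \<exists>a\<in>A. a \<le> b" by blast
  ultimately show ?case by blast
next
  case (Suc k)
  define p where "p = (\<lambda>a :: nat \<Rightarrow> nat. a(k := 0))"
  have lift: "\<exists>F. finite F \<and> F \<subseteq> B \<and> (\<forall>b\<in>B. \<exists>a\<in>F. p a \<le> p b)" if "B \<subseteq> A" for B
  proof -
    have "p ` B \<subseteq> vecs k"
      using that Suc.prems vecs_drop unfolding p_def by blast
    from Suc.IH[OF this] obtain F0
      where F0: "finite F0" "F0 \<subseteq> p ` B" "\<forall>b\<in>p ` B. \<exists>a\<in>F0. a \<le> b" by blast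
    from finite_subset_image[OF F0(1,2)] obtain F where "F \<subseteq> B" "finite F" "F0 = p ` F"
      by blast
    moreover from F0(3) have "\<forall>b\<in>B. \<exists>a\<in>F. p a \<le> p b" unfolding \<open>F0 = p ` F\<close> by simp
    ultimately show ?thesis by (intro exI[of _ F]) simp
  qed
  have le: "a \<le> b" if "p a \<le> p b" "a k \<le> b k" for a b
  proof (rule le_funI)
    show "a i \<le> b i" for i
      using that le_funD[OF that(1), of i] by (cases "i = k") (simp_all add: p_def)
  qed
  from lift[of A] obtain F1
    where F1: "finite F1" "F1 \<subseteq> A" "\<And>b. b \<in> A \<Longrightarrow> \<exists>a\<in>F1. p a \<le> p b" by blast
  define J where "J = (\<Sum>a\<in>F1. a k)"
  have J: "a k \<le> J" if "a \<in> F1" for a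
    unfolding J_def using that F1(1) by (intro member_le_sum) auto
  have "\<exists>F. finite F \<and> F \<subseteq> {a\<in>A. a k = j} \<and> (\<forall>b\<in>{a\<in>A. a k = j}. \<exists>a\<in>F. p a \<le> p b)" for j
    by (rule lift) auto
  then have "\<forall>j. \<exists>F. finite F \<and> F \<subseteq> {a\<in>A. a k = j} \<and> (\<forall>b\<in>{a\<in>A. a k = j}. \<exists>a\<in>F. p a \<le> p b)" ..
  from choice[OF this] obtain F2 where "\<forall>j. finite (F2 j) \<and> F2 j \<subseteq> {a\<in>A. a k = j}
      \<and> (\<forall>b\<in>{a\<in>A. a k = j}. \<exists>a\<in>F2 j. p a \<le> p b)" ..
  then have F2: "finite (F2 j)" "F2 j \<subseteq> {a\<in>A. a k = j}"
    "\<forall>b\<in>{a\<in>A. a k = j}. \<exists>a\<in>F2 j. p a \<le> p b" for j by simp_all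
  show ?case
  proof (intro exI conjI ballI)
    show "finite (F1 \<union> (\<Union>j<J. F2 j))" using F1 F2 by auto
    show "F1 \<union> (\<Union>j<J. F2 j) \<subseteq> A" using F1 F2(2) by blast
    fix b assume b: "b \<in> A"
    show "\<exists>a\<in>F1 \<union> (\<Union>j<J. F2 j). a \<le> b"
    proof (cases "b k < J")
      case True
      with F2(3)[of "b k"] b obtain a where "a \<in> F2 (b k)" "p a \<le> p b" by blast
      moreover from this F2(2) have "a k = b k" by auto
      ultimately show ?thesis using True le[of a b] by auto
    next
      case False
      from F1(3)[OF b] obtain a where "a \<in> F1" "p a \<le> p b" by blast
      moreover from this J have "a k \<le> b k" using False by fastforce
      ultimately show ?thesis using le[of a b] by auto
    qed
  qed
qed

text \<open>
  In terms of monomial ideals this is the colon ideal by the last variable.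
\<close>
definition shift :: "nat \<Rightarrow> (nat \<Rightarrow> nat) set \<Rightarrow> (nat \<Rightarrow> nat) set" where
  "shift k I = {a \<in> vecs (Suc k). a(k := Suc (a k)) \<in> I}"

lemma up_set_shift:
  assumes "up_set (Suc k) I" shows "up_set (Suc k) (shift k I)"
  unfolding up_set_def
proof (intro conjI ballI impI)
  show "shift k I \<subseteq> vecs (Suc k)" by (auto simp: shift_def)
  fix a b assume ab: "a \<in> shift k I" "b \<in> vecs (Suc k)" "a \<le> b"
  then have "a(k := Suc (a k)) \<in> I" "a(k := Suc (a k)) \<le> b(k := Suc (b k))"
    "b(k := Suc (b k)) \<in> vecs (Suc k)"
    by (auto simp: shift_def le_fun_def vecs_def)
  with assms have "b(k := Suc (b k)) \<in> I" unfolding up_set_def by blast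
  with ab show "b \<in> shift k I" by (simp add: shift_def)
qed

lemma up_set_face:
  assumes "up_set (Suc k) I" shows "up_set k (I \<inter> vecs k)"
proof -
  have "vecs k \<subseteq> vecs (Suc k)" by (auto simp: vecs_def)
  with assms show ?thesis unfolding up_set_def by blast
qed

text \<open>
  A vector either has last coordinate \<open>0\<close>, or it arises from a unique vector of the shifted set
  by raising the last coordinate, which costs one degree.
\<close>
lemma hilbert_rec:
  assumes "I \<subseteq> vecs (Suc k)"
  shows "hilbert (Suc k) I = hilbert k (I \<inter> vecs k) + fps_X * hilbert (Suc k) (shift k I)"
proof (rule fps_ext)
  fix n
  have split: "layer (Suc k) I n = layer k (I \<inter> vecs k) n \<union> {a \<in> layer (Suc k) I n. a k > 0}"
  proof -
    have "a \<in> vecs k \<longleftrightarrow> a k = 0" if "a \<in> I" for a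
      using that assms vecs_Suc_zero[of a k] by (auto simp: vecs_def)
    then show ?thesis by (auto simp: layer_def deg_def)
  qed
  have fin: "finite (layer (Suc k) I n)" using assms by (rule finite_layer)
  have c: "card (layer (Suc k) I n)
      = card (layer k (I \<inter> vecs k) n) + card {a \<in> layer (Suc k) I n. a k > 0}"
  proof (subst split, rule card_Un_disjoint)
    show "finite (layer k (I \<inter> vecs k) n)" by (rule finite_layer) simp
    show "finite {a \<in> layer (Suc k) I n. a k > 0}" using fin by simp
  qed (auto simp: layer_def vecs_def)
  have "card {a \<in> layer (Suc k) I n. a k > 0}
      = (if n = 0 then 0 else card (layer (Suc k) (shift k I) (n - 1)))"
  proof (cases n)
    case 0
    then have "{a \<in> layer (Suc k) I n. a k > 0} = {}" by (auto simp: layer_def deg_def)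
    then show ?thesis using 0 by (simp only: card.empty if_True refl simp_thms)
  next
    case (Suc l)
    have "bij_betw (\<lambda>a. a(k := Suc (a k))) (layer (Suc k) (shift k I) l)
        {a \<in> layer (Suc k) I n. a k > 0}"
    proof (rule bij_betw_byWitness[where f' = "\<lambda>a. a(k := a k - 1)"])
      show "(\<lambda>a. a(k := a k - 1)) ` {a \<in> layer (Suc k) I n. a k > 0}
          \<subseteq> layer (Suc k) (shift k I) l"
        using assms Suc by (auto simp: layer_def deg_Suc deg_upd shift_def vecs_def)
    qed (use Suc in \<open>auto simp: layer_def deg_Suc deg_upd shift_def\<close>)
    then show ?thesis using Suc by (simp add: bij_betw_same_card)
  qed
  with c show "fps_nth (hilbert (Suc k) I) n =
      fps_nth (hilbert k (I \<inter> vecs k) + fps_X * hilbert (Suc k) (shift k I)) n"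
    by (simp add: hilbert_def)
qed

lemma one_minus_X: "fps_of_poly [:1, -1 :: 'a :: comm_ring_1:] = 1 - fps_X"
  by (rule fps_ext) (simp add: coeff_pCons split: nat.split)

text \<open>
  Iterated shifts of an up-closed set increase, and they are stable after any number of steps that
  bounds the last coordinates of a finite generating set. Once the set equals its shift, the
  recursion \<open>hilbert_rec\<close> becomes \<open>(1 - z) H(I) = H(face)\<close>, and the face has one variable less. The
  inner induction is on the number \<open>J\<close> of shifts until then.
\<close>
lemma hilbert_rational:
  "up_set k I \<Longrightarrow> \<exists>Q. (1 - fps_X) ^ k * hilbert k I = fps_of_poly Q"
proof (induction k arbitrary: I)
  case 0
  have "layer 0 I n = (if n = 0 then I else {})" for n
    by (auto simp: layer_def deg_def)
  then have "hilbert 0 I = fps_of_poly [:int (card I):]"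
    by (intro fps_ext) (simp add: hilbert_def coeff_pCons split: nat.split)
  then show ?case by auto
next
  case (Suc k)
  note face_IH = Suc.IH
  have main: "\<exists>Q. (1 - fps_X) ^ Suc k * hilbert (Suc k) I = fps_of_poly Q"
    if "up_set (Suc k) I" "\<And>a. a \<in> vecs (Suc k) \<Longrightarrow> a(k := Suc (a k + J)) \<in> I \<Longrightarrow> a(k := a k + J) \<in> I"
    for I J using that
  proof (induction J arbitrary: I)
    case 0
    have "shift k I = I"
    proof
      show "shift k I \<subseteq> I" using 0(2) by (auto simp: shift_def fun_upd_def)
      show "I \<subseteq> shift k I"
      proof
        fix a assume a: "a \<in> I"
        then have "a \<in> vecs (Suc k)" using 0(1) by (auto simp: up_set_def)
        moreover from this have "a(k := Suc (a k)) \<in> vecs (Suc k)" by (simp add: vecs_def)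
        moreover have "a \<le> a(k := Suc (a k))" by (simp add: le_fun_def)
        ultimately show "a \<in> shift k I" using 0(1) a by (auto simp: shift_def up_set_def)
      qed
    qed
    with hilbert_rec[of I k] 0(1) have "(1 - fps_X) * hilbert (Suc k) I = hilbert k (I \<inter> vecs k)"
      by (simp add: up_set_def algebra_simps)
    then have "(1 - fps_X) ^ Suc k * hilbert (Suc k) I = (1 - fps_X) ^ k * hilbert k (I \<inter> vecs k)"
      by (simp only: power_Suc2 mult.assoc)
    with face_IH[OF up_set_face[OF 0(1)]] show ?case by (simp only:)
  next
    case (Suc J)
    have "up_set (Suc k) (shift k I)" by (rule up_set_shift[OF Suc.prems(1)])
    moreover have "a(k := a k + J) \<in> shift k I"
      if "a \<in> vecs (Suc k)" "a(k := Suc (a k + J)) \<in> shift k I" for a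
      using that Suc.prems(2)[of a] by (auto simp: shift_def vecs_def fun_upd_def cong: if_cong)
    ultimately have "\<exists>Q1. (1 - fps_X) ^ Suc k * hilbert (Suc k) (shift k I) = fps_of_poly Q1"
      by (rule Suc.IH)
    then obtain Q1
      where Q1: "(1 - fps_X) ^ Suc k * hilbert (Suc k) (shift k I) = fps_of_poly Q1" ..
    from face_IH[OF up_set_face[OF Suc.prems(1)]] obtain Q2
      where Q2: "(1 - fps_X) ^ k * hilbert k (I \<inter> vecs k) = fps_of_poly Q2" ..
    have "(1 - fps_X) ^ Suc k * hilbert (Suc k) I
        = (1 - fps_X) * ((1 - fps_X) ^ k * hilbert k (I \<inter> vecs k))
          + fps_X * ((1 - fps_X) ^ Suc k * hilbert (Suc k) (shift k I))"
      using Suc.prems(1) by (subst hilbert_rec) (simp_all add: up_set_def distrib_left mult_ac)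
    also have "\<dots> = fps_of_poly ([:1,-1:] * Q2 + [:0,1:] * Q1)"
      unfolding Q1 Q2 by (simp add: fps_of_poly_add fps_of_poly_mult one_minus_X)
    finally show ?case by blast
  qed
  from Suc.prems have "I \<subseteq> vecs (Suc k)" by (simp add: up_set_def)
  from dickson[OF this] obtain F where F: "finite F" "F \<subseteq> I" "\<And>b. b \<in> I \<Longrightarrow> \<exists>a\<in>F. a \<le> b" by blast
  show ?case
  proof (rule main[OF Suc.prems, of "\<Sum>f\<in>F. f k"])
    fix a assume a: "a \<in> vecs (Suc k)" "a(k := Suc (a k + (\<Sum>f\<in>F. f k))) \<in> I"
    from F(3)[OF a(2)] obtain f where f: "f \<in> F" "f \<le> a(k := Suc (a k + (\<Sum>f\<in>F. f k)))" by blast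
    have "f k \<le> (\<Sum>f\<in>F. f k)" using f F(1) by (intro member_le_sum) auto
    then have "f i \<le> (a(k := a k + (\<Sum>f\<in>F. f k))) i" for i
      using le_funD[OF f(2), of i] by (cases "i = k") simp_all
    then have "f \<le> a(k := a k + (\<Sum>f\<in>F. f k))" by (rule le_funI)
    moreover have "a(k := a k + (\<Sum>f\<in>F. f k)) \<in> vecs (Suc k)" using a by (simp add: vecs_def)
    ultimately show "a(k := a k + (\<Sum>f\<in>F. f k)) \<in> I"
      using f F(2) Suc.prems unfolding up_set_def by blast
  qed
qed

lemma less_fun_add:
  fixes a b c :: "nat \<Rightarrow> nat"
  assumes "less_fun a b" shows "less_fun (\<lambda>i. a i + c i) (\<lambda>i. b i + c i)"
  using assms unfolding less_fun_def by auto

lemma ex_less_fun_minimal: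
  assumes "finite A" "A \<noteq> {}"
  shows "\<exists>a\<in>A. \<forall>b\<in>A. \<not> less_fun b a"
  using assms
proof (induction A rule: finite_ne_induct)
  case (singleton x) then show ?case by (simp add: less_fun_irrefl)
next
  case (insert x A)
  then obtain a where a: "a \<in> A" "\<And>b. b \<in> A \<Longrightarrow> \<not> less_fun b a" by blast
  show ?case
  proof (cases "less_fun x a")
    case True
    with a show ?thesis using less_fun_trans less_fun_irrefl by (metis insert_iff)
  next
    case False
    with a show ?thesis by blast
  qed
qed

text \<open>
  The lexicographic order makes one vector of each class of \<open>\<pi>\<close> canonical within its degree.
  The set \<open>N\<close> of the other ones is up-closed: \<open>cong\<close> says that \<open>\<pi>\<close> identifies the translates of
  two identified vectors, and the order is translation invariant. So \<open>Y n\<close> is counted by the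
  degree \<open>n\<close> part of \<open>I - N\<close>.
\<close>
lemma graded_action_rational:
  fixes \<pi> :: "(nat \<Rightarrow> nat) \<Rightarrow> 'g" and Y :: "nat \<Rightarrow> 'g set"
  assumes cong: "\<And>a b c. \<lbrakk>a \<in> vecs k; b \<in> vecs k; c \<in> vecs k; deg k a = deg k b; \<pi> a = \<pi> b\<rbrakk>
      \<Longrightarrow> \<pi> (\<lambda>i. a i + c i) = \<pi> (\<lambda>i. b i + c i)"
    and onto: "\<And>n y. y \<in> Y n \<Longrightarrow> \<exists>a\<in>vecs k. deg k a = n \<and> \<pi> a = y"
    and act: "\<And>a c. \<lbrakk>a \<in> vecs k; c \<in> vecs k; \<pi> a \<in> Y (deg k a)\<rbrakk>
      \<Longrightarrow> \<pi> (\<lambda>i. a i + c i) \<in> Y (deg k a + deg k c)"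
  shows "\<exists>Q. (1 - fps_X) ^ k * Abs_fps (\<lambda>n. int (card (Y n))) = fps_of_poly Q"
proof -
  define I where "I = {a \<in> vecs k. \<pi> a \<in> Y (deg k a)}"
  define N where "N = {a \<in> I. \<exists>b\<in>vecs k. deg k b = deg k a \<and> \<pi> b = \<pi> a \<and> less_fun b a}"
  have sum_diff: "b = (\<lambda>i. a i + (b i - a i))" if "a \<le> b" for a b :: "nat \<Rightarrow> nat"
    using that by (auto simp: le_fun_def)
  have I_add: "(\<lambda>i. a i + c i) \<in> I" if "a \<in> I" "c \<in> vecs k" for a c
    using that act unfolding I_def by (simp add: vecs_add deg_add)
  have N_add: "(\<lambda>i. a i + c i) \<in> N" if a: "a \<in> N" and c: "c \<in> vecs k" for a c
  proof -
    from a obtain b where b: "b \<in> vecs k" "deg k b = deg k a" "\<pi> b = \<pi> a" "less_fun b a" "a \<in> I"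
      by (auto simp: N_def)
    have "\<pi> (\<lambda>i. b i + c i) = \<pi> (\<lambda>i. a i + c i)"
      using cong[of b a c] b c by (simp add: I_def)
    with b c show ?thesis
      unfolding N_def using I_add[of a c] less_fun_add[of b a c] vecs_add[of b k c]
      by (auto simp: deg_add intro!: bexI[of _ "\<lambda>i. b i + c i"])
  qed
  have sub: "N \<subseteq> I" "I \<subseteq> vecs k" by (auto simp: N_def I_def)
  have upI: "up_set k I" unfolding up_set_def
  proof (intro conjI ballI impI sub)
    show "b \<in> I" if "a \<in> I" "b \<in> vecs k" "a \<le> b" for a b
      using I_add[OF that(1) vecs_diff[OF that(2), of a]] by (simp flip: sum_diff[OF that(3)])
  qed
  have upN: "up_set k N" unfolding up_set_def
  proof (intro conjI ballI impI)
    show "N \<subseteq> vecs k" using sub by blast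
    show "b \<in> N" if "a \<in> N" "b \<in> vecs k" "a \<le> b" for a b
      using N_add[OF that(1) vecs_diff[OF that(2), of a]] by (simp flip: sum_diff[OF that(3)])
  qed
  have card: "card (layer k I n) = card (Y n) + card (layer k N n)" for n
  proof -
    have "bij_betw \<pi> (layer k I n - layer k N n) (Y n)"
      unfolding bij_betw_def
    proof
      show "inj_on \<pi> (layer k I n - layer k N n)"
      proof (rule inj_onI)
        fix a b assume a: "a \<in> layer k I n - layer k N n" and b: "b \<in> layer k I n - layer k N n"
          and eq: "\<pi> a = \<pi> b"
        have "{i. a i \<noteq> b i} \<subseteq> {..<k}"
        proof
          fix i assume "i \<in> {i. a i \<noteq> b i}"
          moreover have "a \<in> vecs k" "b \<in> vecs k" using a b sub(2) by (auto simp: layer_def)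
          ultimately show "i \<in> {..<k}" by (auto simp: vecs_def not_less intro: ccontr)
        qed
        then have "less_fun a b \<or> a = b \<or> less_fun b a"
          by (intro less_fun_trichotomy finite_subset[OF _ finite_lessThan])
        with a b eq sub(2) show "a = b" by (auto simp: layer_def N_def)
      qed
      show "\<pi> ` (layer k I n - layer k N n) = Y n"
      proof
        show "\<pi> ` (layer k I n - layer k N n) \<subseteq> Y n" by (auto simp: layer_def I_def)
        show "Y n \<subseteq> \<pi> ` (layer k I n - layer k N n)"
        proof
          fix y assume y: "y \<in> Y n"
          define A where "A = {a \<in> layer k (vecs k) n. \<pi> a = y}"
          have "finite A" using finite_layer[of "vecs k" k n] by (simp add: A_def)
          moreover have "A \<noteq> {}" using onto[OF y] by (auto simp: A_def layer_def)
          ultimately obtain a where a: "a \<in> A" "\<forall>b\<in>A. \<not> less_fun b a"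
            using ex_less_fun_minimal[of A] by blast
          from a(1) have "a \<in> vecs k" "deg k a = n" "\<pi> a = y"
            by (simp_all add: A_def layer_def)
          moreover from this a(2) have "a \<notin> N"
            by (auto simp: A_def layer_def N_def)
          ultimately have "a \<in> layer k I n - layer k N n"
            using y by (simp add: layer_def I_def)
          then show "y \<in> \<pi> ` (layer k I n - layer k N n)" using a by (auto simp: A_def)
        qed
      qed
    qed
    then have "card (Y n) = card (layer k I n - layer k N n)" by (simp add: bij_betw_same_card)
    moreover have "layer k N n \<subseteq> layer k I n" using sub by (auto simp: layer_def)
    moreover have "finite (layer k I n)" using sub by (intro finite_layer)
    ultimately show ?thesis
      by (simp add: card_Diff_subset finite_subset card_mono)
  qed
  have "Abs_fps (\<lambda>n. int (card (Y n))) = hilbert k I - hilbert k N"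
    by (rule fps_ext) (simp add: hilbert_def card)
  moreover from hilbert_rational[OF upI] hilbert_rational[OF upN]
  obtain Q1 Q2 where "(1 - fps_X) ^ k * hilbert k I = fps_of_poly Q1"
    "(1 - fps_X) ^ k * hilbert k N = fps_of_poly Q2" by blast
  ultimately show ?thesis
    by (intro exI[of _ "Q1 - Q2"]) (simp add: fps_of_poly_diff right_diff_distrib)
qed

section \<open>The order of the pole and the growth of the coefficients\<close>

lemma binomial_series:
  "(1 - fps_X) ^ Suc s * Abs_fps (\<lambda>n. int ((n + s) choose s)) = 1"
proof (induction s)
  case 0
  show ?case
    by (rule fps_ext) (simp add: left_diff_distrib)
next
  case (Suc s)
  have "(1 - fps_X) * Abs_fps (\<lambda>n. int ((n + Suc s) choose Suc s))
      = Abs_fps (\<lambda>n. int ((n + s) choose s))"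
  proof (rule fps_ext)
    fix n
    show "fps_nth ((1 - fps_X) * Abs_fps (\<lambda>n. int ((n + Suc s) choose Suc s))) n
        = fps_nth (Abs_fps (\<lambda>n. int ((n + s) choose s))) n"
      by (cases n) (simp_all add: left_diff_distrib)
  qed
  with Suc.IH show ?case by (simp only: power_Suc2[of _ "Suc s"] mult.assoc)
qed

lemma binomial_lim:
  "(\<lambda>n. real ((n - d + s) choose s) / real n ^ s) \<longlonglongrightarrow> (\<Prod>i = 0..<s. 1 / real (s - i))"
proof -
  have "(\<lambda>n. \<Prod>i = 0..<s. real (n - d + s - i) / real n * (1 / real (s - i)))
      \<longlonglongrightarrow> (\<Prod>i = 0..<s. 1 * (1 / real (s - i)))"
  proof (intro tendsto_prod tendsto_mult tendsto_const)
    fix i assume i: "i \<in> {0..<s}"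
    have "(\<lambda>n. 1 + (real s - real i - real d) * inverse (real n)) \<longlonglongrightarrow> 1 + (real s - real i - real d) * 0"
      by (intro tendsto_intros LIMSEQ_inverse_real_of_nat[THEN LIMSEQ_imp_Suc])
    moreover have "\<forall>\<^sub>F n in sequentially. 1 + (real s - real i - real d) * inverse (real n)
        = real (n - d + s - i) / real n"
      using eventually_ge_at_top[of "Suc d"]
      by eventually_elim (use i in \<open>auto simp: field_simps of_nat_diff\<close>)
    ultimately show "(\<lambda>n. real (n - d + s - i) / real n) \<longlonglongrightarrow> 1"
      by (simp add: tendsto_cong)
  qed
  moreover have "(\<Prod>i = 0..<s. real (n - d + s - i) / real n * (1 / real (s - i)))
      = real ((n - d + s) choose s) / real n ^ s" for n
    by (subst binomial_altdef_of_nat) (simp_all add: prod_dividef prod.distrib)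
  ultimately show ?thesis by simp
qed

text \<open>
  Multiplying by the binomial series expresses \<open>b n\<close>, for large \<open>n\<close>, as a fixed linear combination
  of shifted binomial coefficients, each asymptotic to \<open>n\<^sup>s / s!\<close>. The product on the right is
  \<open>1 / s!\<close>.
\<close>
lemma rational_growth:
  fixes b :: "nat \<Rightarrow> nat" and P :: "int poly"
  assumes "(1 - fps_X) ^ Suc s * Abs_fps (\<lambda>n. int (b n)) = fps_of_poly P"
  shows "(\<lambda>n. real (b n) / real n ^ s)
    \<longlonglongrightarrow> real_of_int (poly P 1) * (\<Prod>i = 0..<s. 1 / real (s - i))"
proof -
  define F where "F = Abs_fps (\<lambda>n. int ((n + s) choose s))"
  have "Abs_fps (\<lambda>n. int (b n)) = ((1 - fps_X) ^ Suc s * F) * Abs_fps (\<lambda>n. int (b n))"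
    using binomial_series[of s] by (simp add: F_def)
  also have "\<dots> = fps_of_poly P * F" by (simp only: assms[symmetric] mult_ac)
  finally have "fps_nth (Abs_fps (\<lambda>n. int (b n))) n = fps_nth (fps_of_poly P * F) n" for n by simp
  then have b: "int (b n) = (\<Sum>i\<le>n. coeff P i * int ((n - i + s) choose s))" for n
    by (simp add: fps_mult_nth F_def atLeast0AtMost)
  have b': "real (b n) / real n ^ s
      = (\<Sum>i\<le>degree P. real_of_int (coeff P i) * (real ((n - i + s) choose s) / real n ^ s))"
    if "n \<ge> degree P" for n
  proof -
    have "int (b n) = (\<Sum>i\<le>degree P. coeff P i * int ((n - i + s) choose s))"
      unfolding b using that by (intro sum.mono_neutral_right) (auto simp: coeff_eq_0)
    then have "real_of_int (int (b n)) = real_of_int (\<Sum>i\<le>degree P. coeff P i * int ((n - i + s) choose s))"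
      by simp
    then show ?thesis by (simp add: sum_divide_distrib)
  qed
  have "(\<lambda>n. \<Sum>i\<le>degree P. real_of_int (coeff P i) * (real ((n - i + s) choose s) / real n ^ s))
      \<longlonglongrightarrow> (\<Sum>i\<le>degree P. real_of_int (coeff P i) * (\<Prod>i = 0..<s. 1 / real (s - i)))"
    by (intro tendsto_sum tendsto_mult tendsto_const binomial_lim)
  also have "(\<Sum>i\<le>degree P. real_of_int (coeff P i) * (\<Prod>i = 0..<s. 1 / real (s - i)))
      = real_of_int (poly P 1) * (\<Prod>i = 0..<s. 1 / real (s - i))"
    by (simp add: poly_altdef sum_distrib_right)
  finally show ?thesis
    by (rule Lim_transform_eventually)
      (rule eventually_mono[OF eventually_ge_at_top[of "degree P"] b'[symmetric]])
qed

text \<open>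
  The factors \<open>1 - z\<close> cannot all cancel: otherwise the series would be a polynomial, against
  the positivity of its coefficients.
\<close>
lemma cancel_pole:
  fixes b :: "nat \<Rightarrow> nat" and Q :: "int poly"
  assumes "(1 - fps_X) ^ k * Abs_fps (\<lambda>n. int (b n)) = fps_of_poly Q"
    and pos: "\<And>n. n \<ge> n0 \<Longrightarrow> b n > 0"
  shows "\<exists>s P. (1 - fps_X) ^ Suc s * Abs_fps (\<lambda>n. int (b n)) = fps_of_poly P \<and> poly P 1 \<noteq> 0"
  using assms(1)
proof (induction k arbitrary: Q)
  case 0
  then have "int (b n) = coeff Q n" for n
    by (metis fps_nth_Abs_fps fps_of_poly_nth mult_1 power_0)
  from this[of "max n0 (Suc (degree Q))"] pos[of "max n0 (Suc (degree Q))"] show ?case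
    by (simp add: coeff_eq_0)
next
  case (Suc k)
  show ?case
  proof (cases "poly Q 1 = 0")
    case True
    then obtain R where R: "Q = [:-1, 1:] * R" by (auto simp: poly_eq_0_iff_dvd dvd_def)
    then have "Q = [:1, -1:] * (- R)" by simp
    then have "fps_of_poly Q = (1 - fps_X) * fps_of_poly (- R)"
      by (simp only: fps_of_poly_mult one_minus_X)
    with Suc.prems have "(1 - fps_X) * ((1 - fps_X) ^ k * Abs_fps (\<lambda>n. int (b n)))
        = (1 - fps_X) * fps_of_poly (- R)" by (simp add: mult.assoc)
    moreover have "(1 - fps_X :: int fps) \<noteq> 0"
      by (metis fps_of_poly_0 fps_of_poly_eq_iff one_minus_X pCons_eq_0_iff one_neq_zero)
    ultimately have "(1 - fps_X) ^ k * Abs_fps (\<lambda>n. int (b n)) = fps_of_poly (- R)"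
      by (metis mult_left_cancel)
    then show ?thesis by (rule Suc.IH)
  qed (use Suc.prems in blast)
qed

lemma growth_exponent_ge:
  fixes b :: "nat \<Rightarrow> nat"
  assumes lim: "(\<lambda>n. real (b n) / real n ^ s) \<longlonglongrightarrow> l"
    and "L > 0" and le: "\<And>m. Suc m ^ q \<le> b (m * L + c)"
  shows "q \<le> s"
proof (rule ccontr)
  assume "\<not> q \<le> s"
  have "\<forall>\<^sub>F n in sequentially. real (b n) / real n ^ s < l + 1"
    using lim by (rule order_tendstoD) simp
  then obtain n1 where n1: "\<And>n. n \<ge> n1 \<Longrightarrow> real (b n) / real n ^ s < l + 1"
    by (auto simp: eventually_at_top_linorder)
  define K where "K = l + 1"
  have "K > 0" using n1[of n1] by (auto simp: K_def intro: le_less_trans[rotated])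
  define C where "C = K * real (L + c) ^ s"
  obtain m where m: "m \<ge> Suc n1" "real m \<ge> C"
    by (metis nle_le of_nat_le_iff order_trans real_arch_simple)
  have big: "m * L + c \<ge> m" using \<open>L > 0\<close> by (simp add: trans_le_add1)
  have "real (Suc m) * real (Suc m) ^ s = real (Suc m ^ Suc s)"
    by (simp only: of_nat_power of_nat_mult power_Suc)
  also have "\<dots> \<le> real (Suc m ^ q)"
    using \<open>\<not> q \<le> s\<close> by (intro of_nat_mono power_increasing) auto
  also have "\<dots> \<le> real (b (m * L + c))" using le by (intro of_nat_mono)
  also have "\<dots> \<le> K * real (m * L + c) ^ s"
  proof -
    have "real (b (m * L + c)) / real (m * L + c) ^ s \<le> K"
      using n1[of "m * L + c"] big m by (simp add: K_def)
    moreover have "real (m * L + c) ^ s > 0" using big m by (simp only: zero_less_power of_nat_0_less_iff)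
    ultimately show ?thesis by (simp only: pos_divide_le_eq)
  qed
  also have "\<dots> \<le> K * real ((L + c) * Suc m) ^ s"
    using \<open>K > 0\<close> by (intro mult_left_mono power_mono of_nat_mono) (auto simp: algebra_simps)
  also have "\<dots> = C * real (Suc m) ^ s"
    by (simp only: C_def of_nat_mult power_mult_distrib mult.assoc)
  finally have "real (Suc m) \<le> C" by (rule mult_right_le_imp_le) simp
  with m show False by simp
qed

lemma growth_exponent_le:
  fixes b :: "nat \<Rightarrow> nat"
  assumes lim: "(\<lambda>n. real (b n) / real n ^ s) \<longlonglongrightarrow> l" and "l > 0"
    and le: "\<And>n. b n \<le> A * (2 * (n * M) + 1) ^ r"
  shows "s \<le> r"
proof (rule ccontr)
  assume "\<not> s \<le> r"
  define K where "K = l / 2"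
  have K: "0 < K" "K < l" using \<open>l > 0\<close> by (auto simp: K_def)
  from order_tendstoD(1)[OF lim K(2)]
  obtain n1 where n1: "\<And>n. n \<ge> n1 \<Longrightarrow> K < real (b n) / real n ^ s"
    by (auto simp: eventually_at_top_linorder)
  define C where "C = real A * real (2 * M + 1) ^ r / K"
  obtain n where n: "n \<ge> Suc n1" "real n \<ge> C + 1"
    by (metis nle_le of_nat_le_iff order_trans real_arch_simple)
  have "K * real n * real n ^ r = K * real n ^ Suc r" by simp
  also have "\<dots> \<le> K * real n ^ s"
    using \<open>\<not> s \<le> r\<close> n K by (intro mult_left_mono power_increasing) auto
  also have "\<dots> \<le> real (b n)"
    using n1[of n] n by (simp add: pos_less_divide_eq)
  also have "\<dots> \<le> real (A * (2 * (n * M) + 1) ^ r)" using le by (intro of_nat_mono)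
  also have "\<dots> \<le> real (A * ((2 * M + 1) * n) ^ r)"
    using n by (intro of_nat_mono mult_left_mono power_mono) (auto simp: algebra_simps)
  also have "\<dots> = K * C * real n ^ r" using K
    by (simp only: C_def of_nat_mult of_nat_power power_mult_distrib times_divide_eq_right) simp
  finally have "K * real n \<le> K * C" using n by (simp add: mult_right_le_imp_le)
  with K n show False by simp
qed

section \<open>Products of powers in an abelian group\<close>

definition pow_prod :: "('a, 'm) monoid_scheme \<Rightarrow> ('i \<Rightarrow> 'a) \<Rightarrow> 'i set \<Rightarrow> ('i \<Rightarrow> int) \<Rightarrow> 'a" where
  "pow_prod G f A k = finprod G (\<lambda>i. f i [^]\<^bsub>G\<^esub> k i) A"

lemma int_independent_iff:
  "int_independent G B \<longleftrightarrow>
    (\<forall>k. pow_prod G (\<lambda>b. b) B k = \<one>\<^bsub>G\<^esub> \<longrightarrow> (\<forall>b\<in>B. k b = 0))"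
  by (simp add: int_independent_def pow_prod_def)

context comm_group
begin

lemma pow_prod_closed [simp]:
  "f \<in> A \<rightarrow> carrier G \<Longrightarrow> pow_prod G f A k \<in> carrier G"
  unfolding pow_prod_def by (rule finprod_closed) auto

lemma pow_prod_cong:
  assumes "f \<in> A \<rightarrow> carrier G" "\<And>i. i \<in> A \<Longrightarrow> k i = l i"
  shows "pow_prod G f A k = pow_prod G f A l"
  unfolding pow_prod_def using assms by (intro finprod_cong') auto

lemma pow_prod_zero: "f \<in> A \<rightarrow> carrier G \<Longrightarrow> pow_prod G f A (\<lambda>i. 0) = \<one>"
  unfolding pow_prod_def by (simp add: finprod_one_eqI)

lemma pow_prod_add:
  assumes "f \<in> A \<rightarrow> carrier G"
  shows "pow_prod G f A (\<lambda>i. k i + l i) = pow_prod G f A k \<otimes> pow_prod G f A l"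
proof -
  have "pow_prod G f A (\<lambda>i. k i + l i) = finprod G (\<lambda>i. f i [^] k i \<otimes> f i [^] l i) A"
    unfolding pow_prod_def using assms by (intro finprod_cong') (auto simp: int_pow_mult Pi_iff)
  also have "\<dots> = pow_prod G f A k \<otimes> pow_prod G f A l"
    unfolding pow_prod_def using assms by (intro finprod_multf) auto
  finally show ?thesis .
qed

lemma pow_prod_uminus:
  assumes "f \<in> A \<rightarrow> carrier G"
  shows "pow_prod G f A (\<lambda>i. - k i) = inv (pow_prod G f A k)"
proof -
  have "pow_prod G f A (\<lambda>i. - k i) \<otimes> pow_prod G f A k = \<one>"
    using pow_prod_add[OF assms, of "\<lambda>i. - k i" k] pow_prod_zero[OF assms] by simp
  with assms show ?thesis by (simp add: inv_equality)
qed

lemma pow_prod_insert: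
  assumes "finite A" "i \<notin> A" "f \<in> A \<rightarrow> carrier G" "f i \<in> carrier G"
  shows "pow_prod G f (insert i A) k = f i [^] k i \<otimes> pow_prod G f A k"
  unfolding pow_prod_def using assms by (subst finprod_insert) auto

lemma pow_prod_single:
  assumes "finite A" "f \<in> A \<rightarrow> carrier G" "i \<in> A"
  shows "pow_prod G f A (\<lambda>j. if j = i then n else 0) = f i [^] n"
proof -
  have "pow_prod G f A (\<lambda>j. if j = i then n else 0)
      = finprod G (\<lambda>j. if i = j then f j [^] n else \<one>) A"
    unfolding pow_prod_def using assms by (intro finprod_cong') (auto simp: Pi_iff)
  also have "\<dots> = f i [^] n" using assms by (intro finprod_singleton) (auto simp: Pi_iff)
  finally show ?thesis .
qed

lemma pow_prod_scale:
  assumes "finite A" "f \<in> A \<rightarrow> carrier G"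
  shows "pow_prod G f A (\<lambda>i. c * k i) = pow_prod G f A k [^] (c :: int)"
  using assms
proof (induction A rule: finite_induct)
  case empty
  then show ?case by (simp add: pow_prod_def)
next
  case (insert i A)
  then have "f \<in> A \<rightarrow> carrier G" "f i \<in> carrier G" by auto
  with insert show ?case
    by (simp add: pow_prod_insert int_pow_distrib int_pow_pow mult.commute[of c])
qed

lemma pow_prod_substitute:
  assumes "finite A" "f \<in> A \<rightarrow> carrier G" "finite B" "h \<in> B \<rightarrow> carrier G"
    and "\<And>i. i \<in> A \<Longrightarrow> f i [^] N i = pow_prod G h B (l i)"
  shows "pow_prod G f A (\<lambda>i. N i * q i) = pow_prod G h B (\<lambda>b. \<Sum>i\<in>A. q i * l i b)"
  using assms(1,2,5)
proof (induction A rule: finite_induct)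
  case empty
  then show ?case using assms by (simp add: pow_prod_zero) (simp add: pow_prod_def)
next
  case (insert i A)
  then have f: "f \<in> A \<rightarrow> carrier G" "f i \<in> carrier G" by auto
  have "f i [^] (N i * q i) = pow_prod G h B (\<lambda>b. q i * l i b)"
    using f insert.prems assms(3,4) by (simp add: pow_prod_scale flip: int_pow_pow)
  then show ?case
    using insert f assms(3,4) by (simp add: pow_prod_insert pow_prod_add)
qed

text \<open>
  Adding \<open>g\<close> to \<open>B\<close> destroys independence, and in the resulting relation the exponent of \<open>g\<close> cannot
  vanish, since \<open>B\<close> itself is independent. The sign of that exponent is absorbed to obtain a
  positive power.
\<close>
lemma power_in_span_of_maximal:
  assumes B: "finite B" "B \<subseteq> carrier G" "int_independent G B"
    and max: "\<And>C. \<lbrakk>finite C; C \<subseteq> carrier G; int_independent G C\<rbrakk> \<Longrightarrow> card C \<le> card B"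
    and g: "g \<in> carrier G"
  shows "\<exists>N l. N > 0 \<and> g [^] int N = pow_prod G (\<lambda>b. b) B l"
proof (cases "g \<in> B")
  case True
  then have "g [^] int 1 = pow_prod G (\<lambda>b. b) B (\<lambda>b. if b = g then int 1 else 0)"
    using B by (subst pow_prod_single) auto
  then show ?thesis by (intro exI[of _ 1]) auto
next
  case False
  have idB: "(\<lambda>b. b) \<in> B \<rightarrow> carrier G" using B by auto
  have "\<not> int_independent G (insert g B)"
    using max[of "insert g B"] B g False by auto
  then obtain k where k: "pow_prod G (\<lambda>b. b) (insert g B) k = \<one>" "\<exists>b\<in>insert g B. k b \<noteq> 0"
    unfolding int_independent_iff by blast
  from k(1) have rel: "g [^] k g \<otimes> pow_prod G (\<lambda>b. b) B k = \<one>"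
    using B g False idB by (subst (asm) pow_prod_insert) auto
  have "k g \<noteq> 0"
  proof
    assume "k g = 0"
    with rel idB have "pow_prod G (\<lambda>b. b) B k = \<one>" by simp
    with B(3) k(2) \<open>k g = 0\<close> show False by (auto simp: int_independent_iff)
  qed
  from rel have inv: "g [^] k g = pow_prod G (\<lambda>b. b) B (\<lambda>b. - k b)"
    using g idB by (simp add: pow_prod_uminus inv_equality[symmetric])
  have "g [^] int (nat \<bar>k g\<bar>) = (g [^] k g) [^] sgn (k g)"
    using g by (simp add: int_pow_pow abs_sgn[of "k g", symmetric])
  also have "\<dots> = pow_prod G (\<lambda>b. b) B (\<lambda>b. sgn (k g) * - k b)"
    unfolding inv by (rule pow_prod_scale[OF B(1) idB, symmetric])
  finally have "g [^] int (nat \<bar>k g\<bar>) = pow_prod G (\<lambda>b. b) B (\<lambda>b. sgn (k g) * - k b)" .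
  with \<open>k g \<noteq> 0\<close> show ?thesis by (intro exI[of _ "nat \<bar>k g\<bar>"]) auto
qed

end

section \<open>Word length\<close>

text \<open>
  The generators are listed by \<open>\<sigma>\<close>, so that exponent vectors become functions on \<open>\<nat>\<close> and can be
  compared lexicographically.
\<close>
locale cayley = comm_group G for G (structure) +
  fixes \<Sigma> :: "'a set" and \<sigma> :: "nat \<Rightarrow> 'a" and m :: nat
  assumes gens_closed: "\<Sigma> \<subseteq> carrier G"
    and gens_sym: "\<And>x. x \<in> \<Sigma> \<Longrightarrow> inv x \<in> \<Sigma>"
    and gens_generate: "generate G \<Sigma> = carrier G"
    and enum: "\<sigma> ` {..<m} = \<Sigma>"
begin

definition word :: "(nat \<Rightarrow> nat) \<Rightarrow> 'a" where
  "word a = pow_prod G \<sigma> {..<m} (\<lambda>i. int (a i))"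

definition len :: "'a \<Rightarrow> nat" where
  "len g = vertex_dist (cayley_graph G \<Sigma>) \<one> g"

lemma enum_closed [simp]: "\<sigma> \<in> {..<m} \<rightarrow> carrier G" "i < m \<Longrightarrow> \<sigma> i \<in> carrier G"
  using gens_closed enum by auto

lemma word_closed [simp]: "word a \<in> carrier G"
  by (simp add: word_def)

lemma word_add: "word (\<lambda>i. a i + b i) = word a \<otimes> word b"
  by (simp add: word_def pow_prod_add)

lemma word_zero: "word (\<lambda>i. 0) = \<one>"
  by (simp add: word_def pow_prod_zero)

lemma word_cong: "(\<And>i. i < m \<Longrightarrow> a i = b i) \<Longrightarrow> word a = word b"
  unfolding word_def by (rule pow_prod_cong) auto

lemma word_Suc:
  assumes "i < m" shows "word (a(i := Suc (a i))) = word a \<otimes> \<sigma> i"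
proof -
  have "word (a(i := Suc (a i))) = pow_prod G \<sigma> {..<m} (\<lambda>j. int (a j) + (if j = i then 1 else 0))"
    unfolding word_def by (rule pow_prod_cong) auto
  with assms show ?thesis by (simp add: pow_prod_add pow_prod_single word_def)
qed

lemma deg_inc: "i < m \<Longrightarrow> deg m (a(i := Suc (a i))) = Suc (deg m a)"
  by (simp add: deg_def sum.remove[of "{..<m}" i])

lemma cayley_steps:
  "parcs (mk_symmetric (cayley_graph G \<Sigma>)) = {(u, u \<otimes> x) |u x. u \<in> carrier G \<and> x \<in> \<Sigma>}"
proof -
  have "\<exists>u' x'. u \<otimes> x = u' \<and> u = u' \<otimes> x' \<and> u' \<in> carrier G \<and> x' \<in> \<Sigma>"
    if "u \<in> carrier G" "x \<in> \<Sigma>" for u x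
    using that gens_closed gens_sym by (intro exI[of _ "u \<otimes> x"] exI[of _ "inv x"]) (auto simp: m_assoc)
  then show ?thesis
    by (auto simp: mk_symmetric_def cayley_graph_def)
qed

lemma relpow_cayley:
  assumes "g \<in> carrier G"
  shows "(g, h) \<in> parcs (mk_symmetric (cayley_graph G \<Sigma>)) ^^ n \<longleftrightarrow>
    (\<exists>a\<in>vecs m. deg m a = n \<and> h = g \<otimes> word a)"
proof (induction n arbitrary: h)
  case 0
  have "word a = \<one>" if "deg m a = 0" for a
    using that word_cong[of a "\<lambda>i. 0"] word_zero by (simp add: deg_def)
  moreover have "(\<lambda>i. 0) \<in> vecs m" "deg m (\<lambda>i. 0) = 0" by (auto simp: vecs_def deg_def)
  ultimately show ?case using assms by auto
next
  case (Suc n)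
  have "(g, h) \<in> parcs (mk_symmetric (cayley_graph G \<Sigma>)) ^^ Suc n \<longleftrightarrow>
      (\<exists>a\<in>vecs m. \<exists>i<m. deg m a = n \<and> h = g \<otimes> word a \<otimes> \<sigma> i)"
  proof
    assume "(g, h) \<in> parcs (mk_symmetric (cayley_graph G \<Sigma>)) ^^ Suc n"
    then obtain y where "(g, y) \<in> parcs (mk_symmetric (cayley_graph G \<Sigma>)) ^^ n"
      "(y, h) \<in> parcs (mk_symmetric (cayley_graph G \<Sigma>))" by auto
    moreover from this(2) obtain x where "x \<in> \<Sigma>" "h = y \<otimes> x" by (auto simp: cayley_steps)
    moreover from this(1) obtain i where "i < m" "x = \<sigma> i" using enum by auto
    ultimately show "\<exists>a\<in>vecs m. \<exists>i<m. deg m a = n \<and> h = g \<otimes> word a \<otimes> \<sigma> i"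
      unfolding Suc.IH by blast
  next
    assume "\<exists>a\<in>vecs m. \<exists>i<m. deg m a = n \<and> h = g \<otimes> word a \<otimes> \<sigma> i"
    then obtain a i where a: "a \<in> vecs m" "i < m" "deg m a = n" "h = g \<otimes> word a \<otimes> \<sigma> i"
      by blast
    then have "(g, g \<otimes> word a) \<in> parcs (mk_symmetric (cayley_graph G \<Sigma>)) ^^ n"
      unfolding Suc.IH by blast
    moreover have "\<sigma> i \<in> \<Sigma>" using a(2) enum by auto
    then have "(g \<otimes> word a, h) \<in> parcs (mk_symmetric (cayley_graph G \<Sigma>))"
      using assms a(4) by (auto simp: cayley_steps)
    ultimately show "(g, h) \<in> parcs (mk_symmetric (cayley_graph G \<Sigma>)) ^^ Suc n" by auto
  qed
  also have "\<dots> \<longleftrightarrow> (\<exists>a\<in>vecs m. deg m a = Suc n \<and> h = g \<otimes> word a)"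
  proof
    assume "\<exists>a\<in>vecs m. \<exists>i<m. deg m a = n \<and> h = g \<otimes> word a \<otimes> \<sigma> i"
    then obtain a i where "a \<in> vecs m" "i < m" "deg m a = n" "h = g \<otimes> word a \<otimes> \<sigma> i" by blast
    with assms show "\<exists>a\<in>vecs m. deg m a = Suc n \<and> h = g \<otimes> word a"
      by (intro bexI[of _ "a(i := Suc (a i))"]) (auto simp: word_Suc deg_inc m_assoc vecs_def)
  next
    assume "\<exists>a\<in>vecs m. deg m a = Suc n \<and> h = g \<otimes> word a"
    then obtain a where a: "a \<in> vecs m" "deg m a = Suc n" "h = g \<otimes> word a" by blast
    have "\<exists>i<m. a i > 0"
    proof (rule ccontr)
      assume "\<not> ?thesis"
      then have "deg m a = 0" by (simp add: deg_def)
      with a show False by simp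
    qed
    then obtain i where i: "i < m" "a i > 0" by blast
    define b where "b = a(i := a i - 1)"
    have ab: "a = b(i := Suc (b i))" using i by (auto simp: b_def)
    have "b \<in> vecs m" using a i by (auto simp: b_def vecs_def)
    moreover have "deg m b = n" using a(2) i unfolding ab by (simp add: deg_inc)
    moreover have "h = g \<otimes> word b \<otimes> \<sigma> i"
      using a(3) assms i unfolding ab by (simp add: word_Suc m_assoc)
    ultimately show "\<exists>a\<in>vecs m. \<exists>i<m. deg m a = n \<and> h = g \<otimes> word a \<otimes> \<sigma> i"
      using i by blast
  qed
  finally show ?case .
qed

lemma ex_word:
  assumes "g \<in> carrier G" shows "\<exists>a\<in>vecs m. word a = g"
proof -
  have gen: "\<exists>a\<in>vecs m. word a = x" if x: "x \<in> \<Sigma>" for x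
  proof -
    from x enum obtain i where i: "i < m" "x = \<sigma> i" by auto
    then show ?thesis using word_Suc[of i "\<lambda>i. 0"] word_zero
      by (intro bexI[of _ "(\<lambda>i. 0)(i := Suc 0)"]) (auto simp: vecs_def)
  qed
  have "g \<in> generate G \<Sigma>" using assms gens_generate by simp
  then show ?thesis
  proof (induction rule: generate.induct)
    case one
    show ?case by (rule bexI[of _ "\<lambda>i. 0"]) (simp_all add: word_zero vecs_def)
  next
    case (eng g h)
    then show ?case by (metis word_add vecs_add)
  qed (auto intro: gen gens_sym)
qed

text \<open>
  This connects the graph distance with exponent vectors: since \<open>G\<close> is commutative, an edge path
  from the identity is determined up to reordering by how often it uses each generator.
\<close>
lemma len_le_iff:
  assumes "g \<in> carrier G"
  shows "len g \<le> n \<longleftrightarrow> (\<exists>a\<in>vecs m. deg m a \<le> n \<and> word a = g)"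
proof -
  have iff: "(\<one>, g) \<in> parcs (mk_symmetric (cayley_graph G \<Sigma>)) ^^ k \<longleftrightarrow>
      (\<exists>a\<in>vecs m. deg m a = k \<and> word a = g)" for k
    using relpow_cayley[of \<one> g k] by auto
  have least: "len g = (LEAST k. \<exists>a\<in>vecs m. deg m a = k \<and> word a = g)"
    unfolding len_def vertex_dist_def iff ..
  show ?thesis
  proof
    assume "len g \<le> n"
    moreover have "\<exists>a\<in>vecs m. deg m a = len g \<and> word a = g"
      unfolding least by (rule LeastI_ex) (use ex_word[OF assms] in blast)
    ultimately show "\<exists>a\<in>vecs m. deg m a \<le> n \<and> word a = g" by metis
  next
    assume "\<exists>a\<in>vecs m. deg m a \<le> n \<and> word a = g"
    then obtain a where "a \<in> vecs m" "deg m a \<le> n" "word a = g" by blast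
    moreover from this have "len g \<le> deg m a" unfolding least by (intro Least_le) blast
    ultimately show "len g \<le> n" by simp
  qed
qed

lemma len_word: "a \<in> vecs m \<Longrightarrow> len (word a) \<le> deg m a"
  by (auto simp: len_le_iff)

lemma len_one: "len \<one> = 0"
  using len_word[of "\<lambda>i. 0"] by (simp add: word_zero deg_def vecs_def)

lemma len_mult:
  assumes "g \<in> carrier G" "h \<in> carrier G"
  shows "len (g \<otimes> h) \<le> len g + len h"
proof -
  from assms len_le_iff[of g "len g"] len_le_iff[of h "len h"] obtain a b
    where "a \<in> vecs m" "deg m a \<le> len g" "word a = g" "b \<in> vecs m" "deg m b \<le> len h" "word b = h"
    by auto
  then show ?thesis
    using assms by (subst len_le_iff) (auto simp: word_add deg_add vecs_add intro!: bexI[of _ "\<lambda>i. a i + b i"])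
qed

lemma len_pow_prod:
  assumes "finite B" "B \<subseteq> carrier G"
  shows "len (pow_prod G (\<lambda>b. b) B (\<lambda>b. int (k b))) \<le> (\<Sum>b\<in>B. k b * len b)"
  using assms
proof (induction B rule: finite_induct)
  case empty
  then show ?case by (simp add: pow_prod_def len_one)
next
  case (insert b B)
  then have b: "b \<in> carrier G" "(\<lambda>b. b) \<in> B \<rightarrow> carrier G" by auto
  have pow: "len (b [^] int n) \<le> n * len b" for n
  proof (induction n)
    case (Suc n)
    have "b [^] int (Suc n) = b [^] int n \<otimes> b"
      using b int_pow_mult[of b "int n" 1] by (simp add: add.commute)
    with Suc b len_mult[of "b [^] int n" b] show ?case by simp
  qed (simp add: len_one)
  have "len (pow_prod G (\<lambda>b. b) (insert b B) (\<lambda>b. int (k b)))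
      \<le> len (b [^] int (k b)) + len (pow_prod G (\<lambda>b. b) B (\<lambda>b. int (k b)))"
    using insert b by (simp add: pow_prod_insert len_mult)
  also have "\<dots> \<le> k b * len b + (\<Sum>b\<in>B. k b * len b)"
    using insert pow by (intro add_mono) auto
  finally show ?case using insert by simp
qed

end

section \<open>Morphisms as translations\<close>

locale cayley_subgraph = cayley G \<Sigma> \<sigma> m
  for G (structure) and \<Sigma> :: "'a set" and \<sigma> m +
  fixes S :: "('a, 'a \<times> 'a) pre_digraph" and v0 :: 'a
  assumes sub: "subgraph S (cayley_graph G \<Sigma>)"
    and fin: "fin_digraph S"
    and conn: "Digraph_Component.connected S"
    and base: "v0 \<in> verts S"
begin

text \<open>
  The second condition says that the interior point at distance \<open>t\<close> along the translate of the
  edge \<open>(h, x)\<close> lies in the ball: it is reached through one of the two end points.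
\<close>
definition fits :: "nat \<Rightarrow> 'a set" where
  "fits n = {g \<in> carrier G. (\<forall>v\<in>verts S. len (g \<otimes> v) \<le> n) \<and>
     (\<forall>(h, x)\<in>arcs S. \<forall>t :: real. 0 < t \<and> t < 1 \<longrightarrow>
        min (real (len (g \<otimes> h)) + t) (real (len (g \<otimes> (h \<otimes> x))) + 1 - t) \<le> real n)}"

definition translate :: "'a \<Rightarrow> ('a \<Rightarrow> 'a) \<times> ('a \<times> 'a \<Rightarrow> 'a \<times> 'a)" where
  "translate g = (\<lambda>v\<in>verts S. g \<otimes> v, \<lambda>e\<in>arcs S. (g \<otimes> fst e, snd e))"

lemma fitsD:
  fixes t :: real
  assumes "g \<in> fits n"
  shows "g \<in> carrier G" "v \<in> verts S \<Longrightarrow> len (g \<otimes> v) \<le> n"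
    "(h, x) \<in> arcs S \<Longrightarrow> 0 < t \<Longrightarrow> t < 1 \<Longrightarrow>
      min (real (len (g \<otimes> h)) + t) (real (len (g \<otimes> (h \<otimes> x))) + 1 - t) \<le> real n"
proof -
  have *: "\<forall>v\<in>verts S. len (g \<otimes> v) \<le> n" "\<forall>(h, x)\<in>arcs S. \<forall>t :: real. 0 < t \<and> t < 1 \<longrightarrow>
        min (real (len (g \<otimes> h)) + t) (real (len (g \<otimes> (h \<otimes> x))) + 1 - t) \<le> real n"
    using assms unfolding fits_def mem_Collect_eq by simp_all
  show "g \<in> carrier G" using assms by (simp only: fits_def mem_Collect_eq)
  show "v \<in> verts S \<Longrightarrow> len (g \<otimes> v) \<le> n" by (rule bspec[OF *(1)])
  show "(h, x) \<in> arcs S \<Longrightarrow> 0 < t \<Longrightarrow> t < 1 \<Longrightarrow>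
      min (real (len (g \<otimes> h)) + t) (real (len (g \<otimes> (h \<otimes> x))) + 1 - t) \<le> real n"
    using bspec[OF *(2), of "(h, x)"] by simp
qed

lemma verts_closed: "v \<in> verts S \<Longrightarrow> v \<in> carrier G"
  using sub by (auto simp: subgraph_def cayley_graph_def)

lemma arc_closed:
  assumes "(h, x) \<in> arcs S"
  shows "h \<in> verts S" "x \<in> \<Sigma>" "h \<otimes> x \<in> verts S"
proof -
  from sub have wf: "wf_digraph S" and t: "tail S = fst" "head S = (\<lambda>(g, x). g \<otimes> x)"
    and arcs: "arcs S \<subseteq> carrier G \<times> \<Sigma>"
    by (simp_all add: subgraph_def compatible_def cayley_graph_def)
  from wf_digraph.tail_in_verts[OF wf assms] wf_digraph.head_in_verts[OF wf assms] t arcs assms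
  show "h \<in> verts S" "x \<in> \<Sigma>" "h \<otimes> x \<in> verts S" by auto
qed

lemma tail_head: "tail S = fst" "head S = (\<lambda>(g, x). g \<otimes> x)"
  using sub by (simp_all add: subgraph_def compatible_def cayley_graph_def)

lemma connected_induct:
  assumes "v \<in> verts S" "P v0"
    and "\<And>h x. (h, x) \<in> arcs S \<Longrightarrow> P h \<longleftrightarrow> P (h \<otimes> x)"
  shows "P v"
proof -
  have "v0 \<rightarrow>\<^sup>*\<^bsub>with_proj (mk_symmetric S)\<^esub> v"
    using conn base assms(1) by (simp add: connected_def strongly_connected_def mk_symmetric_def)
  then have "(v0, v) \<in> (arcs_ends (with_proj (mk_symmetric S)))\<^sup>*"
    unfolding reachable_def by (rule rtrancl_on_rtranclI)
  then show ?thesis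
  proof (induction rule: rtrancl_induct)
    case (step y z)
    then show ?case using assms(3) tail_head by (auto simp: mk_symmetric_def arcs_ends_def arc_to_ends_def)
  qed (rule assms(2))
qed

lemma translate_morphism:
  assumes "g \<in> carrier G" shows "translate g \<in> graph_morphisms S (cayley_graph G \<Sigma>)"
proof -
  have arc: "h \<in> verts S \<and> h \<in> carrier G \<and> x \<in> \<Sigma> \<and> x \<in> carrier G \<and> h \<otimes> x \<in> verts S"
    if "(h, x) \<in> arcs S" for h x
    using arc_closed[OF that] verts_closed gens_closed by auto
  show ?thesis
    unfolding graph_morphisms_def translate_def cayley_graph_def tail_head
    using assms verts_closed by (auto simp: m_assoc dest!: arc)
qed

text \<open>
  Along an edge labelled \<open>x\<close> both the vertex map and a left translation multiply by \<open>x\<close>. Hence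
  they agree at one end point iff they agree at the other, and agreement at \<open>v0\<close> spreads over the
  connected graph \<open>S\<close>.
\<close>
lemma morphism_translate:
  assumes "f \<in> graph_morphisms S (cayley_graph G \<Sigma>)"
  shows "f \<in> translate ` carrier G"
proof -
  obtain \<phi> \<psi> where f: "f = (\<phi>, \<psi>)" by (cases f)
  from assms have phi: "\<phi> \<in> verts S \<rightarrow>\<^sub>E carrier G" and psi: "\<psi> \<in> arcs S \<rightarrow>\<^sub>E carrier G \<times> \<Sigma>"
    and e: "\<And>e. e \<in> arcs S \<Longrightarrow> snd (\<psi> e) = snd e \<and> fst (\<psi> e) = \<phi> (fst e) \<and>
      (\<lambda>(g, x). g \<otimes> x) (\<psi> e) = \<phi> ((\<lambda>(g, x). g \<otimes> x) e)"
    by (auto simp: f graph_morphisms_def cayley_graph_def tail_head)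
  have psi_eq: "\<psi> (h, x) = (\<phi> h, x)" and phi_mult: "\<phi> (h \<otimes> x) = \<phi> h \<otimes> x"
    if "(h, x) \<in> arcs S" for h x
    using e[OF that] by (auto simp: prod_eq_iff split_beta)
  define g where "g = \<phi> v0 \<otimes> inv v0"
  have g: "g \<in> carrier G" using phi base verts_closed by (auto simp: g_def)
  have phi_eq: "\<phi> v = g \<otimes> v" if "v \<in> verts S" for v
    using that
  proof (rule connected_induct)
    have "\<phi> v0 \<in> carrier G" using phi base by auto
    then show "\<phi> v0 = g \<otimes> v0" using verts_closed[OF base] by (simp add: g_def m_assoc)
    fix h x assume hx: "(h, x) \<in> arcs S"
    have "\<phi> h \<in> carrier G" using arc_closed[OF hx] phi by auto
    moreover have "h \<in> carrier G" "x \<in> carrier G"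
      using arc_closed[OF hx] verts_closed gens_closed by auto
    ultimately show "(\<phi> h = g \<otimes> h) \<longleftrightarrow> (\<phi> (h \<otimes> x) = g \<otimes> (h \<otimes> x))"
      using g by (simp add: phi_mult[OF hx] flip: m_assoc)
  qed
  have "\<phi> = (\<lambda>v\<in>verts S. g \<otimes> v)"
    using phi phi_eq by (auto simp: PiE_def extensional_def fun_eq_iff restrict_def)
  moreover have "\<psi> = (\<lambda>e\<in>arcs S. (g \<otimes> fst e, snd e))"
  proof (rule extensionalityI[of _ "arcs S"])
    show "\<psi> e = (\<lambda>e\<in>arcs S. (g \<otimes> fst e, snd e)) e" if "e \<in> arcs S" for e
      using that psi_eq[of "fst e" "snd e"] phi_eq[of "fst e"] arc_closed[of "fst e" "snd e"] by simp
  qed (use psi in \<open>auto simp: PiE_def\<close>)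
  ultimately show ?thesis using g by (auto simp: f translate_def)
qed

lemma inj_translate: "inj_on translate (carrier G)"
proof (rule inj_onI)
  fix g h assume gh: "g \<in> carrier G" "h \<in> carrier G" "translate g = translate h"
  from arg_cong[OF gh(3), of "\<lambda>p. fst p v0"] base have "g \<otimes> v0 = h \<otimes> v0"
    by (simp add: translate_def)
  with gh verts_closed[OF base] show "g = h" by simp
qed

lemma vertex_in_ball:
  "Vertex g \<in> cayley_ball G \<Sigma> n \<longleftrightarrow> g \<in> carrier G \<and> len g \<le> n"
proof -
  have "point_dist (cayley_graph G \<Sigma>) (Vertex \<one>) (Vertex g) = real (len g)"
    by (simp add: point_dist_def len_def)
  then show ?thesis by (auto simp: cayley_ball_def points_def cayley_graph_def)
qed

lemma interior_in_ball:
  fixes t :: real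
  shows "Interior (h, x) t \<in> cayley_ball G \<Sigma> n \<longleftrightarrow>
    h \<in> carrier G \<and> x \<in> \<Sigma> \<and> 0 < t \<and> t < 1 \<and> min (real (len h) + t) (real (len (h \<otimes> x)) + 1 - t) \<le> real n"
proof -
  have "point_dist (cayley_graph G \<Sigma>) (Vertex \<one>) (Interior (h, x) t)
      = min (real (len h) + t) (real (len (h \<otimes> x)) + 1 - t)"
    by (simp add: point_dist_def len_def cayley_graph_def algebra_simps)
  then show ?thesis by (auto simp: cayley_ball_def points_def cayley_graph_def)
qed

lemma translate_fits:
  assumes "g \<in> carrier G"
  shows "map_pt (translate g) ` points S \<subseteq> cayley_ball G \<Sigma> n \<longleftrightarrow> g \<in> fits n"
proof -
  have V: "map_pt (translate g) (Vertex v) = Vertex (g \<otimes> v)" if "v \<in> verts S" for v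
    using that by (simp add: translate_def)
  have I: "map_pt (translate g) (Interior e t) = Interior (g \<otimes> fst e, snd e) t"
    if "e \<in> arcs S" for e t
    using that by (simp add: translate_def)
  have pts: "(\<forall>p\<in>points S. P p) \<longleftrightarrow> (\<forall>v\<in>verts S. P (Vertex v)) \<and>
      (\<forall>e\<in>arcs S. \<forall>t. 0 < t \<and> t < 1 \<longrightarrow> P (Interior e t))" for P
    unfolding points_def by blast
  have "map_pt (translate g) ` points S \<subseteq> cayley_ball G \<Sigma> n \<longleftrightarrow>
      (\<forall>v\<in>verts S. Vertex (g \<otimes> v) \<in> cayley_ball G \<Sigma> n) \<and>
      (\<forall>e\<in>arcs S. \<forall>t. 0 < t \<and> t < 1 \<longrightarrow> Interior (g \<otimes> fst e, snd e) t \<in> cayley_ball G \<Sigma> n)"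
    unfolding image_subset_iff pts by (simp add: V I)
  also have "\<dots> \<longleftrightarrow> g \<in> fits n"
  proof -
    have "Interior (g \<otimes> h, x) t \<in> cayley_ball G \<Sigma> n \<longleftrightarrow>
        min (real (len (g \<otimes> h)) + t) (real (len (g \<otimes> (h \<otimes> x))) + 1 - t) \<le> real n"
      if "(h, x) \<in> arcs S" "0 < t" "t < 1" for h x and t :: real
    proof -
      have "h \<in> carrier G" "x \<in> \<Sigma>" "x \<in> carrier G"
        using arc_closed[OF that(1)] verts_closed gens_closed by auto
      with assms that show ?thesis by (simp add: interior_in_ball m_assoc)
    qed
    moreover have "Vertex (g \<otimes> v) \<in> cayley_ball G \<Sigma> n \<longleftrightarrow> len (g \<otimes> v) \<le> n"
      if "v \<in> verts S" for v
      using assms verts_closed[OF that] by (simp add: vertex_in_ball)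
    ultimately show ?thesis using assms unfolding fits_def by auto
  qed
  finally show ?thesis .
qed

lemma ball_count_eq: "ball_count G \<Sigma> S n = card (fits n)"
proof -
  have "{f \<in> graph_morphisms S (cayley_graph G \<Sigma>). map_pt f ` points S \<subseteq> cayley_ball G \<Sigma> n}
      = translate ` fits n"
  proof
    show "translate ` fits n
        \<subseteq> {f \<in> graph_morphisms S (cayley_graph G \<Sigma>). map_pt f ` points S \<subseteq> cayley_ball G \<Sigma> n}"
    proof
      fix f assume "f \<in> translate ` fits n"
      then obtain g where g: "f = translate g" "g \<in> fits n" by blast
      from g(2) have "g \<in> carrier G" by (rule fitsD(1))
      with g translate_morphism[of g] translate_fits[of g n]
      show "f \<in> {f \<in> graph_morphisms S (cayley_graph G \<Sigma>). map_pt f ` points S \<subseteq> cayley_ball G \<Sigma> n}"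
        by blast
    qed
    show "{f \<in> graph_morphisms S (cayley_graph G \<Sigma>). map_pt f ` points S \<subseteq> cayley_ball G \<Sigma> n}
        \<subseteq> translate ` fits n"
      using morphism_translate translate_fits by blast
  qed
  moreover have "inj_on translate (fits n)"
    using inj_translate by (rule inj_on_subset) (blast dest: fitsD(1))
  ultimately show ?thesis by (simp add: ball_count_def card_image)
qed

text \<open>
  The exponent vector has one coordinate more than \<open>word\<close> looks at. It pads a word of
  length at most \<open>n\<close> to degree exactly \<open>n\<close>, as the generator \<open>(1, 1)\<close> of the graded monoid does.
\<close>
definition rep :: "(nat \<Rightarrow> nat) \<Rightarrow> 'a" where
  "rep a = word a \<otimes> inv v0"

lemma fits_rep:
  assumes "g \<in> fits n"
  shows "\<exists>a\<in>vecs (Suc m). deg (Suc m) a = n \<and> rep a = g"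
proof -
  have g: "g \<in> carrier G" "len (g \<otimes> v0) \<le> n" using fitsD(1)[OF assms] fitsD(2)[OF assms base] .
  have v0: "v0 \<in> carrier G" using verts_closed[OF base] .
  from len_le_iff[of "g \<otimes> v0" n] g v0 obtain a
    where a: "a \<in> vecs m" "deg m a \<le> n" "word a = g \<otimes> v0" by auto
  have "word (a(m := n - deg m a)) = word a" by (rule word_cong) simp
  with a g v0 show ?thesis
    by (intro bexI[of _ "a(m := n - deg m a)"])
      (auto simp: rep_def deg_Suc deg_upd m_assoc vecs_def)
qed

text \<open>
  Commutativity is essential here: \<open>g c v = (g v) c\<close> is within \<open>d\<close> steps of \<open>g v\<close>.
\<close>
lemma fits_mult:
  assumes "g \<in> fits n" "c \<in> carrier G" "len c \<le> d"
  shows "g \<otimes> c \<in> fits (n + d)"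
proof -
  note g = fitsD(1)[OF assms(1)]
  have len: "len (g \<otimes> c \<otimes> v) \<le> len (g \<otimes> v) + d" if "v \<in> carrier G" for v
  proof -
    have "g \<otimes> c \<otimes> v = g \<otimes> v \<otimes> c" using g assms that by (simp add: m_ac)
    with len_mult[of "g \<otimes> v" c] g assms that show ?thesis by simp
  qed
  show ?thesis unfolding fits_def
  proof (intro CollectI conjI ballI case_prodI2 allI impI)
    show "g \<otimes> c \<in> carrier G" using g assms by simp
    show "len (g \<otimes> c \<otimes> v) \<le> n + d" if "v \<in> verts S" for v
    proof -
      have "len (g \<otimes> v) \<le> n" using fitsD(2)[OF assms(1) that] .
      with len[OF verts_closed[OF that]] show ?thesis by simp
    qed
    fix e h x t assume e: "e \<in> arcs S" "e = (h, x)" "0 < t \<and> t < (1 :: real)"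
    then have "h \<in> carrier G" "h \<otimes> x \<in> carrier G"
      using arc_closed[of h x] verts_closed by auto
    note l = this[THEN len]
    have "min (real (len (g \<otimes> h)) + t) (real (len (g \<otimes> (h \<otimes> x))) + 1 - t) \<le> real n"
      using fitsD(3)[OF assms(1), of h x t] e by simp
    moreover have "real (len (g \<otimes> c \<otimes> h)) \<le> len (g \<otimes> h) + d"
      "real (len (g \<otimes> c \<otimes> (h \<otimes> x))) \<le> len (g \<otimes> (h \<otimes> x)) + d" using l by linarith+
    ultimately show "min (real (len (g \<otimes> c \<otimes> h)) + t) (real (len (g \<otimes> c \<otimes> (h \<otimes> x))) + 1 - t) \<le> real (n + d)"
      by auto
  qed
qed

text \<open>
  The extra \<open>1\<close> in the constant pays for points in the interior of edges.
\<close>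
lemma fits_short: "\<exists>c. \<forall>n. \<forall>g\<in>carrier G. len g \<le> n \<longrightarrow> g \<in> fits (n + c)"
proof -
  define c where "c = Suc (\<Sum>v\<in>verts S. len v)"
  have "finite (verts S)" using fin by (simp add: fin_digraph.finite_verts)
  then have v: "Suc (len v) \<le> c" if "v \<in> verts S" for v
    unfolding c_def using that member_le_sum[of v "verts S" len] by simp
  have "\<one> \<in> fits c" unfolding fits_def
  proof (intro CollectI conjI ballI case_prodI2 allI impI)
    show "len (\<one> \<otimes> u) \<le> c" if "u \<in> verts S" for u
      using v[OF that] verts_closed[OF that] by simp
    fix e h x t assume e: "e \<in> arcs S" "e = (h, x)" "0 < t \<and> t < (1 :: real)"
    then have "h \<in> verts S" using arc_closed by auto
    from v[OF this] verts_closed[OF this] e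
    show "min (real (len (\<one> \<otimes> h)) + t) (real (len (\<one> \<otimes> (h \<otimes> x))) + 1 - t) \<le> real c" by auto
  qed simp
  then have "g \<in> fits (n + c)" if "g \<in> carrier G" "len g \<le> n" for g n
    using fits_mult[of \<one> c g n] that by (simp add: add.commute)
  then show ?thesis by blast
qed

section \<open>The order of the pole is the rank\<close>

lemma fits_rational:
  "\<exists>Q. (1 - fps_X) ^ Suc m * Abs_fps (\<lambda>n. int (card (fits n))) = fps_of_poly Q"
proof (rule graded_action_rational[where \<pi> = rep])
  have v0: "v0 \<in> carrier G" using verts_closed[OF base] .
  have rep_add: "rep (\<lambda>i. a i + c i) = rep a \<otimes> word c" for a c
    using v0 by (simp add: rep_def word_add m_ac)
  show "rep (\<lambda>i. a i + c i) = rep (\<lambda>i. b i + c i)" if "rep a = rep b" for a b c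
    using that by (simp add: rep_add)
  show "\<exists>a\<in>vecs (Suc m). deg (Suc m) a = n \<and> rep a = g" if "g \<in> fits n" for n g
    using that by (rule fits_rep)
  show "rep (\<lambda>i. a i + c i) \<in> fits (deg (Suc m) a + deg (Suc m) c)"
    if "rep a \<in> fits (deg (Suc m) a)" for a c
  proof -
    \<comment> \<open>The padding coordinate has to be cleared, as \<open>len_word\<close> is about vectors in \<open>vecs m\<close>.\<close>
    define c' where "c' = (\<lambda>i. if i < m then c i else 0)"
    have "word c = word c'" by (rule word_cong) (simp add: c'_def)
    moreover have "c' \<in> vecs m" "deg m c' = deg m c" by (auto simp: c'_def vecs_def deg_def)
    ultimately have "len (word c) \<le> deg (Suc m) c" using len_word[of c'] by (simp add: deg_Suc)
    then show ?thesis unfolding rep_add by (intro fits_mult that) simp_all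
  qed
qed

lemma finite_fits: "finite (fits n)"
proof (rule finite_subset)
  show "fits n \<subseteq> rep ` layer (Suc m) (vecs (Suc m)) n"
    using fits_rep by (fastforce simp: layer_def)
  show "finite (rep ` layer (Suc m) (vecs (Suc m)) n)" by (simp add: finite_layer)
qed

text \<open>
  The products of powers of \<open>B\<close> with exponents in \<open>{0..N}\<close> are distinct by independence, and their
  length is linear in \<open>N\<close>.
\<close>
lemma fits_lower_bound:
  assumes B: "finite B" "B \<subseteq> carrier G" "int_independent G B"
  shows "\<exists>L c. L > 0 \<and> (\<forall>N. Suc N ^ card B \<le> card (fits (N * L + c)))"
proof -
  obtain c where c: "\<And>n g. g \<in> carrier G \<Longrightarrow> len g \<le> n \<Longrightarrow> g \<in> fits (n + c)"
    using fits_short by blast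
  define L where "L = Suc (\<Sum>b\<in>B. len b)"
  have idB: "(\<lambda>b. b) \<in> B \<rightarrow> carrier G" using B by auto
  have "Suc N ^ card B \<le> card (fits (N * L + c))" for N
  proof -
    let ?K = "B \<rightarrow>\<^sub>E {0..N}" and ?p = "\<lambda>k. pow_prod G (\<lambda>b. b) B (\<lambda>b. int (k b))"
    have "inj_on ?p ?K"
    proof (rule inj_onI)
      fix k l assume kl: "k \<in> ?K" "l \<in> ?K" "?p k = ?p l"
      have "pow_prod G (\<lambda>b. b) B (\<lambda>b. int (k b) + - int (l b)) = ?p k \<otimes> inv ?p l"
        using idB by (simp only: pow_prod_add pow_prod_uminus)
      also have "\<dots> = \<one>" using idB by (simp add: kl(3))
      finally have "\<forall>b\<in>B. int (k b) + - int (l b) = 0"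
        using B(3) unfolding int_independent_iff by blast
      then show "k = l" using kl by (intro PiE_ext[OF kl(1,2)]) auto
    qed
    moreover have "?p ` ?K \<subseteq> fits (N * L + c)"
    proof (rule image_subsetI, rule c)
      fix k assume k: "k \<in> ?K"
      show "?p k \<in> carrier G" using idB by simp
      have "len (?p k) \<le> (\<Sum>b\<in>B. k b * len b)" by (rule len_pow_prod[OF B(1,2)])
      also have "\<dots> \<le> (\<Sum>b\<in>B. N * len b)" using k by (intro sum_mono mult_right_mono) auto
      also have "\<dots> \<le> N * L" by (simp add: L_def sum_distrib_left)
      finally show "len (?p k) \<le> N * L" .
    qed
    ultimately have "card ?K \<le> card (fits (N * L + c))"
      using finite_fits by (metis card_inj_on_le)
    then show ?thesis using B(1) by (simp add: card_PiE)
  qed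
  then show ?thesis by (intro exI[of _ L] exI[of _ c]) (simp add: L_def)
qed

text \<open>
  Division with remainder by \<open>N i\<close> splits the exponent of the generator \<open>\<sigma> i\<close>. The remainders range
  over the finite set \<open>R\<close>; the quotients contribute a product of powers of \<open>B\<close>, with exponents
  bounded by \<open>n M\<close> because \<open>\<sigma> i\<close> raised to \<open>N i\<close> is the product of powers of \<open>B\<close> given by \<open>l i\<close>.
\<close>
lemma fits_upper_bound:
  assumes B: "finite B" "B \<subseteq> carrier G" "int_independent G B"
    and max: "\<And>C. \<lbrakk>finite C; C \<subseteq> carrier G; int_independent G C\<rbrakk> \<Longrightarrow> card C \<le> card B"
  shows "\<exists>A M. \<forall>n. card (fits n) \<le> A * (2 * (n * M) + 1) ^ card B"
proof -
  have idB: "(\<lambda>b. b) \<in> B \<rightarrow> carrier G" using B by auto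
  have v0: "v0 \<in> carrier G" using verts_closed[OF base] .
  have "\<forall>i. \<exists>N l. i < m \<longrightarrow> N > 0 \<and> \<sigma> i [^] int N = pow_prod G (\<lambda>b. b) B l"
    using power_in_span_of_maximal[OF B max] enum_closed(2) by blast
  then obtain N l where N: "\<And>i. i < m \<Longrightarrow> N i > (0 :: nat)"
    and l: "\<And>i. i < m \<Longrightarrow> \<sigma> i [^] int (N i) = pow_prod G (\<lambda>b. b) B (l i)"
    by metis
  define M where "M = nat (\<Sum>i<m. \<Sum>b\<in>B. \<bar>l i b\<bar>)"
  have M: "\<bar>l i b\<bar> \<le> int M" if "i < m" "b \<in> B" for i b
  proof -
    have "\<bar>l i b\<bar> \<le> (\<Sum>b\<in>B. \<bar>l i b\<bar>)" using that B(1) by (intro member_le_sum) auto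
    also have "\<dots> \<le> (\<Sum>i<m. \<Sum>b\<in>B. \<bar>l i b\<bar>)"
      using that by (intro member_le_sum[of i]) (auto intro: sum_nonneg)
    also have "\<dots> = int M" unfolding M_def by (simp add: sum_nonneg)
    finally show ?thesis .
  qed
  define R where "R = (\<Pi>\<^sub>E i\<in>{..<m}. {..<N i})"
  have finR: "finite R" by (simp add: R_def finite_PiE)
  have "card (fits n) \<le> card R * (2 * (n * M) + 1) ^ card B" for n
  proof -
    let ?X = "B \<rightarrow>\<^sub>E {- int (n * M)..int (n * M)}"
    let ?p = "\<lambda>(a, x). word a \<otimes> pow_prod G (\<lambda>b. b) B x \<otimes> inv v0"
    have "fits n \<subseteq> ?p ` (R \<times> ?X)"
    proof
      fix g assume "g \<in> fits n"
      then obtain a where a: "deg (Suc m) a = n" "rep a = g" using fits_rep by blast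
      define q where "q = (\<lambda>i. a i div N i)"
      define x where "x = (\<lambda>b\<in>B. \<Sum>i<m. int (q i) * l i b)"
      have "word a = pow_prod G \<sigma> {..<m} (\<lambda>i. int (a i mod N i) + int (N i) * int (q i))"
        unfolding word_def q_def
        by (rule pow_prod_cong) (simp_all flip: of_nat_mult of_nat_add)
      also have "\<dots> = word (\<lambda>i. a i mod N i) \<otimes> pow_prod G \<sigma> {..<m} (\<lambda>i. int (N i) * int (q i))"
        unfolding word_def by (rule pow_prod_add) simp
      also have "pow_prod G \<sigma> {..<m} (\<lambda>i. int (N i) * int (q i))
          = pow_prod G (\<lambda>b. b) B (\<lambda>b. \<Sum>i<m. int (q i) * l i b)"
        using B idB l by (intro pow_prod_substitute) auto
      also have "\<dots> = pow_prod G (\<lambda>b. b) B x"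
        using idB by (rule pow_prod_cong) (simp add: x_def)
      also have "word (\<lambda>i. a i mod N i) = word (\<lambda>i\<in>{..<m}. a i mod N i)"
        by (rule word_cong) simp
      finally have "g = ?p (\<lambda>i\<in>{..<m}. a i mod N i, x)"
        using a(2) by (simp add: rep_def)
      moreover have "(\<lambda>i\<in>{..<m}. a i mod N i) \<in> R" using N by (auto simp: R_def)
      moreover have "x \<in> ?X"
      proof -
        have bound: "\<bar>\<Sum>i<m. int (q i) * l i b\<bar> \<le> int (n * M)" if "b \<in> B" for b
        proof -
          have "\<bar>\<Sum>i<m. int (q i) * l i b\<bar> \<le> (\<Sum>i<m. \<bar>int (q i) * l i b\<bar>)" by (rule sum_abs)
          also have "\<dots> \<le> (\<Sum>i<m. int (a i) * int M)"
            using that M by (intro sum_mono) (auto simp: abs_mult q_def intro!: mult_mono)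
          also have "\<dots> = int (deg m a * M)" by (simp add: deg_def sum_distrib_right)
          also have "\<dots> \<le> int (n * M)" using a(1) by (simp add: deg_Suc flip: of_nat_mult)
          finally show ?thesis .
        qed
        have "x b \<in> {- int (n * M)..int (n * M)}" if "b \<in> B" for b
          using abs_le_D1[OF bound[OF that]] abs_le_D2[OF bound[OF that]] that
          by (simp add: x_def minus_le_iff)
        then show ?thesis unfolding x_def by (intro PiE_I) auto
      qed
      ultimately show "g \<in> ?p ` (R \<times> ?X)" by blast
    qed
    moreover have fin: "finite (R \<times> ?X)" using finR B(1) by (intro finite_SigmaI finite_PiE) auto
    ultimately have "card (fits n) \<le> card (R \<times> ?X)" by (rule surj_card_le[rotated])
    also have "\<dots> = card R * (2 * (n * M) + 1) ^ card B"
    proof -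
      have "card {- int k..int k} = 2 * k + 1" for k by (auto simp: nat_add_distrib)
      then show ?thesis
        using B(1) by (simp only: card_cartesian_product card_PiE prod_constant)
    qed
    finally show ?thesis .
  qed
  then show ?thesis by blast
qed

text \<open>
  The lower bound, applied to every independent set, makes the set of cardinalities in the
  definition of the rank bounded, so its \<open>Max\<close> is attained; at a set that attains it the upper
  bound applies.
\<close>
lemma fits_pole:
  "\<exists>P. (1 - fps_X) ^ Suc (torsion_free_rank G) * Abs_fps (\<lambda>n. int (card (fits n))) = fps_of_poly P
    \<and> poly P 1 \<noteq> 0"
proof -
  obtain c where c: "\<And>n g. g \<in> carrier G \<Longrightarrow> len g \<le> n \<Longrightarrow> g \<in> fits (n + c)"
    using fits_short by blast
  have "card (fits n) > 0" if "n \<ge> c" for n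
    using c[of \<one> "n - c"] that finite_fits[of n] by (auto simp: len_one card_gt_0_iff)
  moreover obtain Q where "(1 - fps_X) ^ Suc m * Abs_fps (\<lambda>n. int (card (fits n))) = fps_of_poly Q"
    using fits_rational ..
  ultimately obtain s P
    where P: "(1 - fps_X) ^ Suc s * Abs_fps (\<lambda>n. int (card (fits n))) = fps_of_poly P" "poly P 1 \<noteq> 0"
    using cancel_pole[where b = "\<lambda>n. card (fits n)"] by blast
  define l where "l = real_of_int (poly P 1) * (\<Prod>i = 0..<s. 1 / real (s - i))"
  have lim: "(\<lambda>n. real (card (fits n)) / real n ^ s) \<longlonglongrightarrow> l"
    unfolding l_def by (rule rational_growth[OF P(1)])
  have "l \<ge> 0" by (rule LIMSEQ_le_const[OF lim]) simp
  moreover have "l \<noteq> 0" using P(2) by (simp add: l_def)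
  ultimately have "l > 0" by simp
  let ?I = "{B. B \<subseteq> carrier G \<and> finite B \<and> int_independent G B}"
  have le_s: "card B \<le> s" if B: "B \<in> ?I" for B
  proof -
    from B obtain L c where "L > 0" "\<And>N. Suc N ^ card B \<le> card (fits (N * L + c))"
      using fits_lower_bound[of B] by blast
    then show ?thesis by (rule growth_exponent_ge[OF lim])
  qed
  have rank: "torsion_free_rank G = Max (card ` ?I)"
    unfolding torsion_free_rank_def by (rule arg_cong[where f = Max]) blast
  have "card ` ?I \<subseteq> {..s}" by (rule image_subsetI) (simp only: atMost_iff le_s)
  then have fin: "finite (card ` ?I)" by (rule finite_subset) simp
  have "{} \<in> ?I" by (simp add: int_independent_def)
  then have "torsion_free_rank G \<in> card ` ?I" unfolding rank by (intro Max_in[OF fin]) blast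
  then obtain B where B: "B \<in> ?I" "card B = torsion_free_rank G" by auto
  have "card C \<le> card B" if "C \<in> ?I" for C
    unfolding B(2) rank by (rule Max_ge[OF fin imageI[OF that]])
  then obtain A M where "\<And>n. card (fits n) \<le> A * (2 * (n * M) + 1) ^ card B"
    using fits_upper_bound[of B] B(1) by blast
  then have "s \<le> card B" by (rule growth_exponent_le[OF lim \<open>l > 0\<close>])
  with le_s[OF B(1)] B(2) have "s = torsion_free_rank G" by simp
  with P show ?thesis by blast
qed

end

section \<open>Passing to rational coefficients\<close>

definition rat_fps :: "int fps \<Rightarrow> rat fps" where
  "rat_fps F = Abs_fps (\<lambda>n. of_int (fps_nth F n))"

lemma rat_fps_mult: "rat_fps (F * H) = rat_fps F * rat_fps H"
  by (rule fps_ext) (simp add: rat_fps_def fps_mult_nth)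

lemma rat_fps_one_minus_X_power: "rat_fps ((1 - fps_X) ^ n) = (1 - fps_X) ^ n"
proof (induction n)
  case 0
  show ?case by (rule fps_ext) (simp add: rat_fps_def)
next
  case (Suc n)
  have "rat_fps (1 - fps_X) = 1 - fps_X" by (rule fps_ext) (simp add: rat_fps_def fps_X_def)
  with Suc show ?case by (simp add: rat_fps_mult)
qed

text \<open>
  A common divisor of \<open>P\<close> and \<open>1 - z\<close> divides the nonzero constant \<open>P(1)\<close>, so it is constant; it is
  a unit because \<open>1 - z\<close> has content \<open>1\<close>.
\<close>
lemma coprime_one_minus_X:
  assumes "poly P 1 \<noteq> (0 :: int)" shows "coprime P ([:1, -1:] ^ r)"
proof -
  have "coprime P [:1, -1:]"
  proof (rule coprimeI)
    fix c assume c: "c dvd P" "c dvd [:1, -1 :: int:]"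
    have "[:-1, 1:] dvd P - [:poly P 1:]" by (simp flip: poly_eq_0_iff_dvd)
    then have "[:1, -1:] dvd P - [:poly P 1:]"
      using minus_dvd_iff[of "[:-1, 1:]" "P - [:poly P 1:]"] by simp
    with c have "c dvd P - (P - [:poly P 1:])" by (meson dvd_diff dvd_trans)
    then have "c dvd [:poly P 1:]" by simp
    from dvd_imp_degree_le[OF this] assms have "degree c = 0" by simp
    then obtain u where u: "c = [:u:]" by (rule degree_eq_zeroE)
    with c(2) have "u dvd coeff [:1, -1:] 0" by (simp only: const_poly_dvd_iff)
    then show "is_unit c" by (simp add: u is_unit_const_poly_iff)
  qed
  then show ?thesis by (simp add: coprime_power_right_iff)
qed

theorem mainTheorem1:
  fixes G :: "('a, 'm) monoid_scheme"
    and \<Sigma> :: "'a set"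
    and S :: "('a, 'a \<times> 'a) pre_digraph"
    and r :: nat
  assumes "comm_group G"
    and "torsion_free_rank G = r"
    and "\<Sigma> \<subseteq> carrier G" and "finite \<Sigma>"
    and "\<forall>x\<in>\<Sigma>. inv\<^bsub>G\<^esub> x \<in> \<Sigma>"
    and "generate G \<Sigma> = carrier G"
    and "subgraph S (cayley_graph G \<Sigma>)"
    and "verts S \<noteq> {}"
    and "fin_digraph S"
    and "Digraph_Component.connected S"
  shows "\<exists>P :: int poly.
    growth_series G \<Sigma> S =
      fps_of_poly (map_poly of_int P) / fps_of_poly ([:1, -1:] ^ r) \<and>
    coprime P ([:1, -1:] ^ r)"
proof -
  from \<open>finite \<Sigma>\<close> obtain \<sigma> and m :: nat where "\<sigma> ` {..<m} = \<Sigma>"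
    by (metis finite_imp_nat_seg_image_inj_on lessThan_def)
  moreover from \<open>verts S \<noteq> {}\<close> obtain v0 where "v0 \<in> verts S" by blast
  ultimately interpret cayley_subgraph G \<Sigma> \<sigma> m S v0
    using assms by (simp add: cayley_subgraph_def cayley_def cayley_axioms_def cayley_subgraph_axioms_def)
  obtain P where P: "(1 - fps_X) ^ Suc r * Abs_fps (\<lambda>n. int (ball_count G \<Sigma> S n)) = fps_of_poly P"
    "poly P 1 \<noteq> 0"
    using fits_pole assms(2) by (auto simp: ball_count_eq)
  have "Abs_fps (sphere_count G \<Sigma> S) = (1 - fps_X) * Abs_fps (\<lambda>n. int (ball_count G \<Sigma> S n))"
    by (rule fps_ext) (simp add: sphere_count_def left_diff_distrib)
  with P(1) have "(1 - fps_X) ^ r * Abs_fps (sphere_count G \<Sigma> S) = fps_of_poly P"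
    by (simp only: power_Suc2 mult.assoc)
  then have "rat_fps ((1 - fps_X) ^ r * Abs_fps (sphere_count G \<Sigma> S)) = rat_fps (fps_of_poly P)"
    by simp
  moreover have "rat_fps (fps_of_poly P) = fps_of_poly (map_poly of_int P)"
    by (rule fps_ext) (simp add: rat_fps_def coeff_map_poly)
  moreover have "rat_fps (Abs_fps (sphere_count G \<Sigma> S)) = growth_series G \<Sigma> S"
    by (simp add: rat_fps_def growth_series_def)
  moreover have "(1 - fps_X) ^ r = fps_of_poly ([:1, -1 :: rat:] ^ r)"
    by (simp add: fps_of_poly_power one_minus_X)
  ultimately have "fps_of_poly (map_poly of_int P) = fps_of_poly ([:1, -1 :: rat:] ^ r) * growth_series G \<Sigma> S"
    by (simp add: rat_fps_mult rat_fps_one_minus_X_power)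
  moreover have "fps_of_poly ([:1, -1 :: rat:] ^ r) \<noteq> 0"
    by (metis fps_of_poly_0 fps_of_poly_eq_iff pCons_eq_0_iff one_neq_zero power_not_zero)
  ultimately have "growth_series G \<Sigma> S
      = fps_of_poly (map_poly of_int P) / fps_of_poly ([:1, -1:] ^ r)"
    by (metis nonzero_mult_div_cancel_left)
  with coprime_one_minus_X[OF P(2)] show ?thesis by blast
qed

end
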